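(* Let $a>0$ and let $q:\mathbb{R}\to\mathbb{R}$ be a real potential with $\int_{\mathbb{R}}|q(x)|^2e^{2a|x|}\,dx<\infty$. Let $\mathbb{D}_{a/3}=\{\lambda\in\mathbb{C}:|\lambda|<a/3\}$. Then for every $\lambda\in\mathbb{D}_{a/3}$ and $k\in\{0,1,2\}$ there exists a Jost solution $u_k(\lambda,x)$, i.e. a solution of $$iy'''(x)+q(x)y(x)=\lambda^3y(x)\quad(x\in\mathbb{R}),\qquad u_k(\lambda,x)-e^{i\lambda\zeta_kx}\to0\quad(x\to-\infty),$$ and it is given by $$u_k(\lambda,x)=e^{i\lambda\zeta_kx}+\int_{-\infty}^x\widehat N(\lambda,x,t)q(t)e^{i\lambda\zeta_kt}\,dt .$$ The functions $u_0,u_1,u_2$ given by this formula are analytic in $\lambda$ in $\mathbb{D}_{a/3}$, and $$u_k(\lambda\zeta_1,x)=u_{k'}(\lambda,x),\qquad k'=(k+1)\bmod 3,\quad 0\le k\le2 .$$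
   Context: $\zeta_0=1$, $\zeta_1=\frac12(-1+i\sqrt3)$, $\zeta_2=\frac12(-1-i\sqrt3)$ are the cube roots of unity, and $s_2(z)=\frac13\sum_{k=0}^2\zeta_k^{-2}e^{\zeta_kz}$ ($z\in\mathbb{C}$). Put $K_1(\lambda,x,t)=\dfrac{s_2(i\lambda(x-t))}{(i\lambda)^2}$ for $\lambda\ne0$ and $K_1(0,x,t)=\frac{(x-t)^2}{2}$ (its limit as $\lambda\to0$). For $t\le x$ let $\widehat K_1=K_1$ and $\widehat K_{n+1}(\lambda,x,t)=\int_t^x\widehat K_n(\lambda,x,s)q(s)K_1(\lambda,s,t)\,ds$ ($n\ge1$); these are the kernels (with weight $q(t)$) of the powers of the Volterra operator $(\widehat K_\lambda f)(x)=\int_{-\infty}^xK_1(\lambda,x,t)q(t)f(t)\,dt$. Let $\widehat N(\lambda,x,t)=\sum_{n=1}^\infty i^n\widehat K_n(\lambda,x,t)$ (a convergent series). *)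

theory Defs
  imports "HOL-Analysis.Analysis"
begin

text \<open>The cube roots of unity; only the indices 0, 1, 2 are used.\<close>

definition zeta :: "nat \<Rightarrow> complex" where
  "zeta k = (if k = 0 then 1
             else if k = 1 then (- 1 + \<i> * of_real (sqrt 3)) / 2
             else (- 1 - \<i> * of_real (sqrt 3)) / 2)"

definition s2 :: "complex \<Rightarrow> complex" where
  "s2 z = (1 / 3) * (\<Sum>k = 0..2. zeta k powi (- 2) * exp (zeta k * z))"

definition K1 :: "complex \<Rightarrow> real \<Rightarrow> real \<Rightarrow> complex" where
  "K1 l x t = (if l = 0 then of_real ((x - t)\<^sup>2 / 2)
               else s2 (\<i> * l * of_real (x - t)) / (\<i> * l)\<^sup>2)"

text \<open>
  The index is shifted: \<open>Khat q n\<close> is the iterated kernel usually numbered \<open>n + 1\<close>, so that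
  \<open>Khat q 0\<close> is \<open>K1\<close>. It is meant for \<open>t \<le> x\<close>; the integral runs over the interval
  from \<open>t\<close> to \<open>x\<close>.
\<close>

primrec Khat :: "(real \<Rightarrow> real) \<Rightarrow> nat \<Rightarrow> complex \<Rightarrow> real \<Rightarrow> real \<Rightarrow> complex" where
  "Khat q 0 l x t = K1 l x t"
| "Khat q (Suc n) l x t =
     (LINT s:{t..x}|lebesgue. Khat q n l x s * of_real (q s) * K1 l s t)"

definition Nhat :: "(real \<Rightarrow> real) \<Rightarrow> complex \<Rightarrow> real \<Rightarrow> real \<Rightarrow> complex" where
  "Nhat q l x t = (\<Sum>n. \<i> ^ Suc n * Khat q n l x t)"

text \<open>
  Absolute continuity of a function on a compact interval, in the classical
  epsilon-delta sense (finite families of non-overlapping subintervals).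
\<close>

definition abs_cont_on :: "real \<Rightarrow> real \<Rightarrow> (real \<Rightarrow> complex) \<Rightarrow> bool" where
  "abs_cont_on c d f \<longleftrightarrow>
     (\<forall>\<epsilon>>0. \<exists>\<delta>>0. \<forall>(n::nat) (a::nat \<Rightarrow> real) (b::nat \<Rightarrow> real).
        (\<forall>i<n. c \<le> a i \<and> a i \<le> b i \<and> b i \<le> d) \<and>
        disjoint_family_on (\<lambda>i. {a i<..<b i}) {..<n} \<and>
        (\<Sum>i<n. b i - a i) < \<delta>
        \<longrightarrow> (\<Sum>i<n. norm (f (b i) - f (a i))) < \<epsilon>)"

definition locally_abs_cont :: "(real \<Rightarrow> complex) \<Rightarrow> bool" where
  "locally_abs_cont f \<longleftrightarrow> (\<forall>c d. c < d \<longrightarrow> abs_cont_on c d f)"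

text \<open>
  Since the potential is only locally square integrable, \<open>i y''' + q y = l^3 y\<close> is understood in
  the sense of Caratheodory: \<open>y\<close> is twice differentiable (with derivatives \<open>y1\<close>, \<open>y2\<close>), its
  second derivative is locally absolutely continuous (hence \<open>y\<close> and \<open>y1\<close> are as well), and the
  equation holds almost everywhere.
\<close>

definition solves_ode :: "(real \<Rightarrow> real) \<Rightarrow> complex \<Rightarrow> (real \<Rightarrow> complex) \<Rightarrow> bool" where
  "solves_ode q l y \<longleftrightarrow>
     (\<exists>y1 y2. (\<forall>x. (y has_vector_derivative y1 x) (at x)) \<and>
              (\<forall>x. (y1 has_vector_derivative y2 x) (at x)) \<and>
              locally_abs_cont y2 \<and>
              (AE x in lebesgue. \<exists>y3. (y2 has_vector_derivative y3) (at x) \<and>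
                 \<i> * y3 + of_real (q x) * y x = l ^ 3 * y x))"

definition jost_solution :: "(real \<Rightarrow> real) \<Rightarrow> nat \<Rightarrow> complex \<Rightarrow> (real \<Rightarrow> complex) \<Rightarrow> bool" where
  "jost_solution q k l y \<longleftrightarrow>
     solves_ode q l y \<and>
     ((\<lambda>x. y x - exp (\<i> * l * zeta k * of_real x)) \<longlongrightarrow> 0) at_bot"

end

(*
The function u = f + N q f with f x = exp (i l zeta_k x) is the Neumann series solution of the
Volterra equation u = f + i K u, where K has kernel K1 l x t * q t. With b = a/3 and |l| <= r < b the
kernel obeys |K1 l x t| <= C exp (b (x - t)), while exp (2 b |t|) q t is integrable by Cauchy-Schwarz;
hence K preserves the functions of size O(exp (b |x|)). The iterated kernels decay like 2^(-n),
uniformly in l, because a bounded weight W >= 1 absorbs each integration: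
C * (integral of |q| W over [t, x]) <= W t / 2. This yields convergence, decay of u - f at -infinity
and, the bounds being locally uniform in l, analyticity. The function k y = K1 l y 0 has third
derivative (i l)^3 k and k 0 = k' 0 = 0, k'' 0 = 1, so Fubini over the triangle writes K u as a
threefold integral, from which regularity and the differential equation are read off. The symmetry
holds because K1 l depends on l only through l^3.
*)

theory Submission
  imports Defs "HOL-Complex_Analysis.Complex_Analysis"
begin

text \<open>The radius b = a/3 comes from counting exponentials. As t tends to -infinity, the kernel
  costs a factor exp (b |t|) and the plane wave another one, since it may grow in either direction.
  Cauchy-Schwarz costs a third, so as to leave the square integrable factor exp (- b |t|). Hence q
  exp (3 b |t|) has to be square integrable.

  The kernel is not small: C times the integral of |q| may exceed 1, so a plain sup norm gives no
  contraction. The usual remedy is a factor 1/n! from ordered integration variables; a weighted sup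
  norm gives geometric decay by a one-step induction instead.

  Two obstacles shape the setting. The constant C blows up as r tends to b, so the estimates live on
  discs of radius r < b and the assertions on the full disc are assembled point by point in l. And q
  is only Lebesgue measurable while Fubini wants product measurability, so q is replaced by a Borel
  representative, which changes no integral.\<close>

section \<open>Integration tools: Fubini on a triangle, integrals holomorphic in a parameter\<close>

lemma integrable_prod_mult:
  fixes f :: "'a \<Rightarrow> real" and g :: "'b \<Rightarrow> real"
  assumes "sigma_finite_measure M" "sigma_finite_measure N"
    and f: "integrable M f" and g: "integrable N g"
  shows "integrable (M \<Otimes>\<^sub>M N) (\<lambda>(x, y). f x * g y)"
proof -
  interpret pair_sigma_finite M N using assms(1,2) by (simp add: pair_sigma_finite_def)
  note [measurable] = borel_measurable_integrable[OF f] borel_measurable_integrable[OF g]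
  show ?thesis
  proof (rule Fubini_integrable)
    show "(\<lambda>(x, y). f x * g y) \<in> borel_measurable (M \<Otimes>\<^sub>M N)" by measurable
    show "integrable M (\<lambda>x. \<integral>y. norm (case (x, y) of (x, y) \<Rightarrow> f x * g y) \<partial>N)"
      using f by (simp add: abs_mult)
    show "AE x in M. integrable N (\<lambda>y. case (x, y) of (x, y) \<Rightarrow> f x * g y)"
      using g by simp
  qed
qed

text \<open>A majorant of product form makes the integrand, extended by zero from the triangle
  \<open>t \<le> s \<le> x\<close>, integrable over the plane. The kernels supply this form because
  exp (b (s - t)) = exp (b s) exp (- b t). The inner integrals are recorded as integrable because
  they are added or integrated again later.\<close>

lemma Fubini_triangle:
  fixes G :: "real \<Rightarrow> real \<Rightarrow> complex" and w v :: "real \<Rightarrow> real"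
  assumes G: "(\<lambda>(s, t). G s t) \<in> borel_measurable (lborel \<Otimes>\<^sub>M lborel)"
    and w: "set_integrable lborel {..x} w" and v: "set_integrable lborel {..x} v"
    and bd: "\<And>s t. t \<le> s \<Longrightarrow> s \<le> x \<Longrightarrow> norm (G s t) \<le> w s * v t"
  shows "(LINT t:{..x}|lborel. LINT s:{t..x}|lborel. G s t) = (LINT s:{..x}|lborel. LINT t:{..s}|lborel. G s t)"
    and "set_integrable lborel {..x} (\<lambda>s. LINT t:{..s}|lborel. G s t)"
    and "set_integrable lborel {..x} (\<lambda>t. LINT s:{t..x}|lborel. G s t)"
proof -
  define H where "H s t = (indicator {..x} s * indicator {..s} t) *\<^sub>R G s t" for s t
  have Hm: "(\<lambda>(s, t). H s t) \<in> borel_measurable (lborel \<Otimes>\<^sub>M lborel)"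
  proof -
    have "Measurable.pred (lborel \<Otimes>\<^sub>M lborel) (\<lambda>p::real \<times> real. snd p \<le> fst p)" by measurable
    hence "(\<lambda>p::real \<times> real. if fst p \<le> x \<and> snd p \<le> fst p then (case p of (s, t) \<Rightarrow> G s t) else 0) \<in> borel_measurable (lborel \<Otimes>\<^sub>M lborel)"
      using G by measurable
    also have "(\<lambda>p::real \<times> real. if fst p \<le> x \<and> snd p \<le> fst p then (case p of (s, t) \<Rightarrow> G s t) else 0) = (\<lambda>(s, t). H s t)"
      by (auto simp: H_def fun_eq_iff indicator_def)
    finally show ?thesis .
  qed
  have "integrable (lborel \<Otimes>\<^sub>M lborel) (\<lambda>(s, t). (indicator {..x} s *\<^sub>R w s) * (indicator {..x} t *\<^sub>R v t))"
    using w v unfolding set_integrable_def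
    by (intro integrable_prod_mult) (auto intro: lborel.sigma_finite_measure_axioms)
  hence int: "integrable (lborel \<Otimes>\<^sub>M lborel) (\<lambda>(s, t). H s t)"
  proof (rule Bochner_Integration.integrable_bound[OF _ Hm], intro AE_I2)
    fix p :: "real \<times> real"
    obtain s t where p: "p = (s, t)" by force
    show "norm (case p of (s, t) \<Rightarrow> H s t) \<le> norm (case p of (s, t) \<Rightarrow> (indicator {..x} s *\<^sub>R w s) * (indicator {..x} t *\<^sub>R v t))"
      using bd[of t s] by (auto simp: p H_def indicator_def)
  qed
  have I1: "(LINT t|lborel. H s t) = indicator {..x} s *\<^sub>R (LINT t:{..s}|lborel. G s t)" for s
    by (simp add: H_def set_lebesgue_integral_def flip: scaleR_scaleR)
  have I2: "(LINT s|lborel. H s t) = indicator {..x} t *\<^sub>R (LINT s:{t..x}|lborel. G s t)" for t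
  proof -
    \<comment> \<open>The sections of the triangle in the other direction: for
      \<open>t \<le> x\<close> the variable \<open>s\<close> runs over \<open>{t..x}\<close>, and
      for \<open>t > x\<close> the section is empty.\<close>
    have "H s t = indicator {..x} t *\<^sub>R (indicator {t..x} s *\<^sub>R G s t)" for s
      by (auto simp: H_def indicator_def)
    thus ?thesis by (simp only: set_lebesgue_integral_def integral_scaleR_right)
  qed
  show "(LINT t:{..x}|lborel. LINT s:{t..x}|lborel. G s t) = (LINT s:{..x}|lborel. LINT t:{..s}|lborel. G s t)"
    using lborel_pair.Fubini_integral[OF int] unfolding I1 I2 by (simp add: set_lebesgue_integral_def)
  show "set_integrable lborel {..x} (\<lambda>s. LINT t:{..s}|lborel. G s t)"
    using lborel_pair.integrable_fst'[OF int] I1 by (simp add: set_integrable_def)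
  show "set_integrable lborel {..x} (\<lambda>t. LINT s:{t..x}|lborel. G s t)"
    using lborel_pair.integrable_snd[OF int] I2 by (simp add: set_integrable_def)
qed

text \<open>Cauchy's inequality converts the majorant of \<open>F\<close> into the majorant
  \<open>h t / r\<close> of its derivative in \<open>l\<close>, hence of the difference quotients;
  dominated convergence then differentiates under the integral. In the applications only values of
  \<open>F\<close> have to be estimated.\<close>

lemma holomorphic_on_integral:
  fixes F :: "complex \<Rightarrow> 'a \<Rightarrow> complex" and h :: "'a \<Rightarrow> real"
  assumes S: "open S"
    and hol: "\<And>t. (\<lambda>l. F l t) holomorphic_on S"
    and meas: "\<And>l. l \<in> S \<Longrightarrow> F l \<in> borel_measurable M"
    and h: "integrable M h"
    and bd: "\<And>l t. l \<in> S \<Longrightarrow> norm (F l t) \<le> h t"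
  shows "(\<lambda>l. \<integral>t. F l t \<partial>M) holomorphic_on S"
proof -
  have int: "integrable M (F l)" if "l \<in> S" for l
  proof (rule Bochner_Integration.integrable_bound[OF h meas[OF that]], intro AE_I2)
    fix t show "norm (F l t) \<le> norm (h t)" using bd[OF that, of t] by simp
  qed
  have "(\<lambda>l. \<integral>t. F l t \<partial>M) field_differentiable (at z)" if z: "z \<in> S" for z
  proof -
    obtain e where e: "e > 0" "cball z e \<subseteq> S" using S z open_contains_cball by blast
    \<comment> \<open>Half the radius, so that a closed disc of radius \<open>r\<close> about any
      point of \<open>ball z r\<close> still lies in \<open>S\<close>, as Cauchy's inequality
      requires.\<close>
    define r where "r = e / 2"
    have r: "r > 0" using e by (simp add: r_def)
    have inS: "cball w r \<subseteq> S" if "w \<in> ball z r" for w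
    proof
      fix v assume "v \<in> cball w r"
      hence "dist z v \<le> e" using that dist_triangle[of z v w] by (simp add: r_def)
      thus "v \<in> S" using e by auto
    qed
    have rS: "ball z r \<subseteq> S" using e by (auto simp: r_def)
    have der: "((\<lambda>l. F l t) has_field_derivative deriv (\<lambda>l. F l t) w) (at w)" if "w \<in> S" for w t
      using hol S that by (rule holomorphic_derivI)
    have dbd: "norm (deriv (\<lambda>l. F l t) w) \<le> h t / r" if w: "w \<in> ball z r" for w t
    proof -
      have "norm ((deriv ^^ 1) (\<lambda>l. F l t) w) \<le> fact 1 * h t / r ^ 1"
      proof (rule Cauchy_inequality)
        show "(\<lambda>l. F l t) holomorphic_on ball w r"
          using hol inS[OF w] ball_subset_cball by (meson holomorphic_on_subset order_trans)
        show "continuous_on (cball w r) (\<lambda>l. F l t)"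
          using hol inS[OF w] by (meson continuous_on_subset holomorphic_on_imp_continuous_on)
        fix x assume "norm (w - x) = r"
        hence "x \<in> S" using inS[OF w] by (auto simp: dist_norm)
        thus "norm (F x t) \<le> h t" by (rule bd)
      qed (use r in auto)
      thus ?thesis by simp
    qed
    have lip: "norm (F w t - F z t) \<le> h t / r * norm (w - z)" if "w \<in> ball z r" for w t
    proof (rule field_differentiable_bound[of "ball z r"])
      show "((\<lambda>l. F l t) has_field_derivative deriv (\<lambda>l. F l t) v) (at v within ball z r)" if "v \<in> ball z r" for v
        by (rule has_field_derivative_at_within, rule der) (use that rS in blast)
      show "norm (deriv (\<lambda>l. F l t) v) \<le> h t / r" if "v \<in> ball z r" for v
        using dbd that .
    qed (use r that in auto)
    have "((\<lambda>w. ((\<integral>t. F w t \<partial>M) - (\<integral>t. F z t \<partial>M)) / (w - z)) \<longlongrightarrow> (\<integral>t. deriv (\<lambda>l. F l t) z \<partial>M)) (at z within ball z r)"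
      \<comment> \<open>Dominated convergence concerns sequences, so the limit is taken along an
        arbitrary one.\<close>
      unfolding tendsto_at_iff_sequentially
    proof (intro allI impI)
      fix X :: "nat \<Rightarrow> complex"
      assume X: "\<forall>i. X i \<in> ball z r - {z}" and Xz: "X \<longlonglongrightarrow> z"
      have XS: "X i \<in> S" for i using X rS by auto
      have conv: "(\<lambda>i. (F (X i) t - F z t) / (X i - z)) \<longlonglongrightarrow> deriv (\<lambda>l. F l t) z" for t
      proof -
        have "((\<lambda>w. (F w t - F z t) / (w - z)) \<longlongrightarrow> deriv (\<lambda>l. F l t) z) (at z)"
          using der[OF z, of t] by (simp add: has_field_derivative_iff)
        hence "(((\<lambda>w. (F w t - F z t) / (w - z)) \<circ> X) \<longlongrightarrow> deriv (\<lambda>l. F l t) z) sequentially"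
          unfolding tendsto_at_iff_sequentially using X Xz by auto
        thus ?thesis by (simp add: o_def)
      qed
      have "(\<lambda>i. \<integral>t. (F (X i) t - F z t) / (X i - z) \<partial>M) \<longlonglongrightarrow> (\<integral>t. deriv (\<lambda>l. F l t) z \<partial>M)"
      proof (rule integral_dominated_convergence[where w = "\<lambda>t. h t / r"])
        show "(\<lambda>t. (F (X i) t - F z t) / (X i - z)) \<in> borel_measurable M" for i
          using meas[OF XS[of i]] meas[OF z] by measurable
        show "(\<lambda>t. deriv (\<lambda>l. F l t) z) \<in> borel_measurable M"
          by (rule borel_measurable_LIMSEQ_metric[where f = "\<lambda>i t. (F (X i) t - F z t) / (X i - z)"])
             (use meas[OF XS] meas[OF z] conv in auto)
        show "AE t in M. norm ((F (X i) t - F z t) / (X i - z)) \<le> h t / r" for i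
        proof (intro AE_I2)
          fix t
          have "X i \<noteq> z" "X i \<in> ball z r" using X by auto
          thus "norm ((F (X i) t - F z t) / (X i - z)) \<le> h t / r"
            using lip[of "X i" t] by (simp add: norm_divide divide_le_eq)
        qed
      qed (use h conv in auto)
      moreover have "(\<integral>t. (F (X i) t - F z t) / (X i - z) \<partial>M) = ((\<integral>t. F (X i) t \<partial>M) - (\<integral>t. F z t \<partial>M)) / (X i - z)" for i
        using int[OF XS[of i]] int[OF z] by simp
      ultimately show "((\<lambda>w. ((\<integral>t. F w t \<partial>M) - (\<integral>t. F z t \<partial>M)) / (w - z)) \<circ> X) \<longlonglongrightarrow> (\<integral>t. deriv (\<lambda>l. F l t) z \<partial>M)"
        by (simp only: o_def)
    qed
    moreover have "at z within ball z r = at z" using r by (intro at_within_open) auto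
    ultimately show ?thesis
      unfolding field_differentiable_def has_field_derivative_iff by auto
  qed
  thus ?thesis
    by (auto simp: holomorphic_on_def intro: field_differentiable_at_within)
qed

section \<open>Primitives of integrable functions: absolute continuity, derivatives almost
  everywhere\<close>

lemma set_integral_atMost_diff:
  fixes h :: "real \<Rightarrow> complex"
  assumes h: "set_integrable lborel {..d} h" and "a \<le> b" "b \<le> d"
  shows "(LINT t:{..b}|lborel. h t) - (LINT t:{..a}|lborel. h t) = (LINT t:{a<..b}|lborel. h t)"
proof -
  have "{..b} = {..a} \<union> {a<..b}" using assms by auto
  moreover have "set_integrable lborel {..a} h" "set_integrable lborel {a<..b} h"
    by (rule set_integrable_subset[OF h]; use assms in auto)+
  moreover have "{..a} \<inter> {a<..b} = {}" by auto
  ultimately show ?thesis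
    by (simp only: set_integral_Un add_diff_cancel_left')
qed

lemma set_integral_interval_endpoints:
  fixes h :: "real \<Rightarrow> complex"
  assumes h: "set_integrable lborel {a..b} h"
  shows "(LINT t:{a<..b}|lborel. h t) = (LINT t:{a..b}|lborel. h t)"
    and "(LINT t:{a<..<b}|lborel. h t) = (LINT t:{a..b}|lborel. h t)"
proof -
  have m: "set_borel_measurable lborel A h" if "A \<in> sets lborel" "A \<subseteq> {a..b}" for A
    using set_integrable_subset[OF h that] unfolding set_integrable_def set_borel_measurable_def
    by (rule borel_measurable_integrable)
  have *: "AE x in lborel. x \<noteq> a \<and> x \<noteq> b"
    using AE_lborel_singleton[of a] AE_lborel_singleton[of b] by eventually_elim auto
  show "(LINT t:{a<..b}|lborel. h t) = (LINT t:{a..b}|lborel. h t)"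
  proof (rule set_integral_cong_set)
    show "AE x in lborel. (x \<in> {a..b}) = (x \<in> {a<..b})" using * by eventually_elim auto
  qed (rule m; auto)+
  show "(LINT t:{a<..<b}|lborel. h t) = (LINT t:{a..b}|lborel. h t)"
  proof (rule set_integral_cong_set)
    show "AE x in lborel. (x \<in> {a..b}) = (x \<in> {a<..<b})" using * by eventually_elim auto
  qed (rule m; auto)+
qed

text \<open>Truncation at a level \<open>N\<close>: where the norm of \<open>h\<close> exceeds
  \<open>N\<close>, its total integral is below \<open>\<epsilon> / 2\<close>; elsewhere the
  increments are at most \<open>N\<close> times the length of the intervals.\<close>

lemma abs_cont_on_integral:
  fixes h :: "real \<Rightarrow> complex"
  assumes h: "set_integrable lborel {..d} h"
    and F: "\<And>x. x \<le> d \<Longrightarrow> F x = C + (LINT t:{..x}|lborel. h t)"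
  shows "abs_cont_on c d F"
  unfolding abs_cont_on_def
proof (intro allI impI)
  fix \<epsilon> :: real assume "\<epsilon> > 0"
  define g where "g t = norm (indicator {..d} t *\<^sub>R h t)" for t
  have g: "integrable lborel g" unfolding g_def
    using h by (intro integrable_norm) (simp add: set_integrable_def)
  have g0: "g t \<ge> 0" for t by (simp add: g_def)
  note [measurable] = borel_measurable_integrable[OF g]
  \<comment> \<open>The large part of \<open>g\<close>. At each point it vanishes once
    \<open>N\<close> reaches \<open>g t\<close>, so its integral tends to 0 by domination by
    \<open>g\<close>.\<close>
  define gN where "gN N t = (if real N < g t then g t else 0)" for N t
  have gNm[measurable]: "gN N \<in> borel_measurable lborel" for N
    unfolding gN_def by measurable
  have gNi: "integrable lborel (gN N)" for N
    by (rule Bochner_Integration.integrable_bound[OF g]) (auto simp: gN_def g0)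
  have "(\<lambda>N. LINT t|lborel. gN N t) \<longlonglongrightarrow> (LINT t::real|lborel. (0::real))"
  proof (rule integral_dominated_convergence[where w = g])
    show "AE t in lborel. (\<lambda>N. gN N t) \<longlonglongrightarrow> 0"
    proof (intro AE_I2)
      fix t
      obtain N0 where "g t < real N0" using reals_Archimedean2 by blast
      hence "\<forall>N\<ge>N0. gN N t = 0" by (auto simp: gN_def)
      thus "(\<lambda>N. gN N t) \<longlonglongrightarrow> 0"
        by (intro tendsto_eventually) (auto simp: eventually_sequentially)
    qed
  qed (use g g0 in \<open>auto simp: gN_def\<close>)
  hence "eventually (\<lambda>N. (LINT t|lborel. gN N t) < \<epsilon> / 2) sequentially"
    using \<open>\<epsilon> > 0\<close> by (intro order_tendstoD(2)) auto
  then obtain N where N: "(LINT t|lborel. gN N t) < \<epsilon> / 2"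
    by (auto simp: eventually_sequentially)
  \<comment> \<open>The summand 1 keeps the denominator positive when \<open>N = 0\<close>.\<close>
  define \<delta> where "\<delta> = \<epsilon> / (2 * (real N + 1))"
  have "\<delta> > 0" using \<open>\<epsilon> > 0\<close> by (simp add: \<delta>_def)
  show "\<exists>\<delta>>0. \<forall>(n::nat) (a::nat \<Rightarrow> real) (b::nat \<Rightarrow> real).
        (\<forall>i<n. c \<le> a i \<and> a i \<le> b i \<and> b i \<le> d) \<and>
        disjoint_family_on (\<lambda>i. {a i<..<b i}) {..<n} \<and>
        (\<Sum>i<n. b i - a i) < \<delta>
        \<longrightarrow> (\<Sum>i<n. norm (F (b i) - F (a i))) < \<epsilon>"
  proof (intro exI conjI allI impI, rule \<open>\<delta> > 0\<close>)
    fix n :: nat and a b :: "nat \<Rightarrow> real"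
    assume asm: "(\<forall>i<n. c \<le> a i \<and> a i \<le> b i \<and> b i \<le> d) \<and>
        disjoint_family_on (\<lambda>i. {a i<..<b i}) {..<n} \<and> (\<Sum>i<n. b i - a i) < \<delta>"
    define I where "I i t = indicator {a i<..<b i} t * gN N t" for i t
    have Ii: "integrable lborel (I i)" for i
      unfolding I_def using integrable_mult_indicator[of "{a i<..<b i}" lborel "gN N"] gNi by simp
    have step: "norm (F (b i) - F (a i)) \<le> real N * (b i - a i) + (LINT t|lborel. I i t)" if "i < n" for i
    proof -
      have ab: "a i \<le> b i" "b i \<le> d" using asm that by auto
      have "F (b i) - F (a i) = (LINT t:{a i<..b i}|lborel. h t)"
        using set_integral_atMost_diff[OF h ab] F ab by simp
      also have "\<dots> = (LINT t:{a i<..<b i}|lborel. h t)"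
        using set_integral_interval_endpoints[OF set_integrable_subset[OF h, of "{a i..b i}"]] ab by auto
      finally have "norm (F (b i) - F (a i)) \<le> (LINT t|lborel. norm (indicator {a i<..<b i} t *\<^sub>R h t))"
        unfolding set_lebesgue_integral_def using integral_norm_bound by metis
      also have "\<dots> \<le> (LINT t|lborel. real N * indicator {a i<..<b i} t + I i t)"
      proof (rule integral_mono)
        have "{a i<..<b i} \<subseteq> {..d}" using ab by auto
        from set_integrable_subset[OF h _ this]
        show "integrable lborel (\<lambda>t. norm (indicator {a i<..<b i} t *\<^sub>R h t))"
          unfolding set_integrable_def by (intro integrable_norm) simp
        show "integrable lborel (\<lambda>t. real N * indicator {a i<..<b i} t + I i t)"
          using Ii ab by (intro Bochner_Integration.integrable_add) auto
        show "norm (indicator {a i<..<b i} t *\<^sub>R h t) \<le> real N * indicator {a i<..<b i} t + I i t" for t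
          using ab by (auto simp: indicator_def I_def gN_def g_def)
      qed
      also have "\<dots> = real N * (b i - a i) + (LINT t|lborel. I i t)"
        using Ii ab by simp
      finally show ?thesis .
    qed
    have "(\<Sum>i<n. norm (F (b i) - F (a i))) \<le> (\<Sum>i<n. real N * (b i - a i) + (LINT t|lborel. I i t))"
      by (intro sum_mono step) auto
    also have "\<dots> = real N * (\<Sum>i<n. b i - a i) + (LINT t|lborel. (\<Sum>i<n. I i t))"
      using Ii by (simp add: sum.distrib sum_distrib_left Bochner_Integration.integral_sum)
    also have "(LINT t|lborel. (\<Sum>i<n. I i t)) \<le> (LINT t|lborel. gN N t)"
    proof (rule integral_mono)
      fix t
      \<comment> \<open>Disjointness enters here: the indicators add up to at most 1, so the large
        parts over all intervals together stay below the integral of \<open>gN N\<close>.\<close>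
      have "(\<Sum>i<n. indicator {a i<..<b i} t :: real) = indicator (\<Union>i<n. {a i<..<b i}) t"
        using asm by (intro indicator_UN_disjoint[symmetric]) auto
      also have "\<dots> \<le> 1" by (simp add: indicator_def)
      finally show "(\<Sum>i<n. I i t) \<le> gN N t"
        using g0[of t] unfolding I_def sum_distrib_right[symmetric]
        by (intro mult_left_le_one_le) (auto simp: gN_def sum_nonneg)
    qed (use Ii gNi in auto)
    also have "real N * (\<Sum>i<n. b i - a i) \<le> real N * \<delta>"
      using asm by (intro mult_left_mono) auto
    also have "real N * \<delta> \<le> \<epsilon> / 2"
      using \<open>\<epsilon> > 0\<close> by (simp add: \<delta>_def field_simps)
    finally show "(\<Sum>i<n. norm (F (b i) - F (a i))) < \<epsilon>" using N by simp
  qed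
qed

text \<open>The underlying differentiation theorem averages over cubes having the point as lower
  corner; on the line these are right-hand averages only.\<close>

lemma AE_right_derivative_integral:
  fixes h :: "real \<Rightarrow> complex"
  assumes "\<And>c d. set_integrable lborel {c..d} h"
  shows "AE x in lebesgue. ((\<lambda>e. (LINT t:{x..x+e}|lborel. h t) /\<^sub>R e) \<longlongrightarrow> h x) (at_right 0)"
proof -
  have i: "h integrable_on cbox c d" for c d
    using set_borel_integral_eq_integral(1)[OF assms] by simp
  obtain N where N: "negligible N"
     and lim: "\<And>x e. \<lbrakk>x \<notin> N; 0 < e\<rbrakk> \<Longrightarrow>
               \<exists>d>0. \<forall>k. 0 < k \<and> k < d \<longrightarrow>
                         norm(integral (cbox x (x + k *\<^sub>R One)) h /\<^sub>R k ^ DIM(real) - h x) < e"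
    using integrable_ccontinuous_explicit[of h] i by metis
  show ?thesis
  proof (rule AE_I')
    show "N \<in> null_sets lebesgue" using N by (simp add: negligible_iff_null_sets)
    show "{x \<in> space lebesgue. \<not> ((\<lambda>e. (LINT t:{x..x+e}|lborel. h t) /\<^sub>R e) \<longlongrightarrow> h x) (at_right 0)} \<subseteq> N"
    proof (rule subsetI, rule ccontr)
      fix x assume x: "x \<in> {x \<in> space lebesgue. \<not> ((\<lambda>e. (LINT t:{x..x+e}|lborel. h t) /\<^sub>R e) \<longlongrightarrow> h x) (at_right 0)}"
        and "x \<notin> N"
      have "((\<lambda>e. (LINT t:{x..x+e}|lborel. h t) /\<^sub>R e) \<longlongrightarrow> h x) (at_right 0)"
      proof (rule tendstoI)
        fix e :: real assume "e > 0"
        from lim[OF \<open>x \<notin> N\<close> this] obtain d where d: "d > 0" "\<And>k. 0 < k \<Longrightarrow> k < d \<Longrightarrow> norm (integral {x..x+k} h /\<^sub>R k - h x) < e"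
          by auto
        thus "eventually (\<lambda>k. dist ((LINT t:{x..x+k}|lborel. h t) /\<^sub>R k) (h x) < e) (at_right 0)"
          unfolding eventually_at_right_field
          by (intro exI[of _ d]) (auto simp: dist_norm set_borel_integral_eq_integral(2)[OF assms])
      qed
      thus False using x by simp
    qed
  qed
qed

lemma set_integral_reflect_real:
  fixes h :: "real \<Rightarrow> complex"
  shows "(LINT t:{c..d}|lborel. h (- t)) = (LINT t:{-d..-c}|lborel. h t)"
proof -
  have *: "indicator {-d..-c} (- t) = (indicator {c..d} t :: real)" for t by (auto simp: indicator_def)
  show ?thesis
    unfolding set_lebesgue_integral_def
    using lborel_integral_real_affine[of "-1" "\<lambda>t. indicator {-d..-c} t *\<^sub>R h t" 0]
    by (simp add: *)
qed

lemma set_integrable_reflect_real: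
  fixes h :: "real \<Rightarrow> complex"
  assumes "set_integrable lborel {-d..-c} h"
  shows "set_integrable lborel {c..d} (\<lambda>t. h (- t))"
proof -
  have *: "indicator {-d..-c} (- t) = (indicator {c..d} t :: real)" for t by (auto simp: indicator_def)
  show ?thesis using assms
    unfolding set_integrable_def
    using lborel_integrable_real_affine[of "\<lambda>t. indicator {-d..-c} t *\<^sub>R h t" "-1" 0]
    by (simp add: *)
qed

lemma has_vector_derivative_if_limit:
  fixes F :: "real \<Rightarrow> 'a::real_normed_vector"
  assumes "((\<lambda>e. (F (x + e) - F x) /\<^sub>R e) \<longlongrightarrow> D) (at 0)"
  shows "(F has_vector_derivative D) (at x)"
proof -
  have "((\<lambda>e. norm ((F (x + e) - F x) /\<^sub>R e - D)) \<longlongrightarrow> 0) (at 0)"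
    using assms by (simp add: LIM_zero_iff tendsto_norm_zero_iff)
  hence "((\<lambda>e. norm (F (x + e) - F x - e *\<^sub>R D) / norm e) \<longlongrightarrow> 0) (at 0)"
  proof (rule Lim_transform_eventually)
    show "eventually (\<lambda>e. norm ((F (x + e) - F x) /\<^sub>R e - D) = norm (F (x + e) - F x - e *\<^sub>R D) / norm e) (at 0)"
      unfolding eventually_at
    proof (intro exI[of _ 1] conjI ballI impI)
      fix e :: real assume "e \<noteq> 0 \<and> dist e 0 < 1"
      hence "(F (x + e) - F x) /\<^sub>R e - D = (F (x + e) - F x - e *\<^sub>R D) /\<^sub>R e"
        by (simp add: scaleR_diff_right)
      thus "norm ((F (x + e) - F x) /\<^sub>R e - D) = norm (F (x + e) - F x - e *\<^sub>R D) / norm e"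
        by (simp add: divide_inverse mult.commute)
    qed simp
  qed
  thus ?thesis
    unfolding has_vector_derivative_def has_derivative_at by (simp add: bounded_linear_scaleR_left)
qed

text \<open>The left-hand averages of \<open>h\<close> at \<open>x\<close> are the right-hand
  averages of the reflected function at \<open>- x\<close>. Negation preserves null sets, so the
  reflected exceptional set is again null, and off both sets the two one-sided limits agree.\<close>

lemma AE_has_vector_derivative_integral:
  fixes h :: "real \<Rightarrow> complex"
  assumes h: "\<And>d. set_integrable lborel {..d} h"
    and F: "\<And>x. F x = C + (LINT t:{..x}|lborel. h t)"
  shows "AE x in lebesgue. (F has_vector_derivative h x) (at x)"
proof -
  have hi: "set_integrable lborel {c..d} h" for c d
    by (rule set_integrable_subset[OF h[of d]]) auto
  have Fd: "F b - F a = (LINT t:{a..b}|lborel. h t)" if "a \<le> b" for a b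
  proof -
    have "F b - F a = (LINT t:{a<..b}|lborel. h t)"
      using set_integral_atMost_diff[OF h that order.refl] F by simp
    also have "\<dots> = (LINT t:{a..b}|lborel. h t)"
      by (rule set_integral_interval_endpoints[OF hi])
    finally show ?thesis .
  qed
  have R: "AE x in lebesgue. ((\<lambda>e. (LINT t:{x..x+e}|lborel. h t) /\<^sub>R e) \<longlongrightarrow> h x) (at_right 0)"
    by (rule AE_right_derivative_integral[OF hi])
  define P where "P x \<longleftrightarrow> ((\<lambda>e. (LINT t:{x..x+e}|lborel. h (- t)) /\<^sub>R e) \<longlongrightarrow> h (- x)) (at_right 0)" for x
  have "AE x in lebesgue. P x"
    unfolding P_def by (rule AE_right_derivative_integral) (rule set_integrable_reflect_real[OF hi])
  then obtain N where N: "N \<in> null_sets lebesgue" "{x \<in> space lebesgue. \<not> P x} \<subseteq> N"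
    by (rule AE_E3) auto
  have "negligible (uminus ` N)"
    using N(1) by (intro negligible_differentiable_image_negligible)
      (auto simp: negligible_iff_null_sets differentiable_on_minus)
  hence "uminus ` N \<in> null_sets lebesgue" by (simp add: negligible_iff_null_sets)
  hence L: "AE x in lebesgue. P (- x)"
  proof (rule AE_I')
    show "{x \<in> space lebesgue. \<not> P (- x)} \<subseteq> uminus ` N"
      using N(2) by (auto simp: image_iff) (metis add.inverse_inverse subset_iff mem_Collect_eq)
  qed
  from R L show ?thesis
  proof eventually_elim
    fix x
    assume r: "((\<lambda>e. (LINT t:{x..x+e}|lborel. h t) /\<^sub>R e) \<longlongrightarrow> h x) (at_right 0)" and l: "P (- x)"
    have r': "((\<lambda>e. (F (x + e) - F x) /\<^sub>R e) \<longlongrightarrow> h x) (at_right 0)"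
      by (rule Lim_transform_eventually[OF r])
         (auto simp: eventually_at_right_field Fd intro!: exI[of _ 1])
    have "((\<lambda>e. (F x - F (x - e)) /\<^sub>R e) \<longlongrightarrow> h x) (at_right 0)"
    proof (rule Lim_transform_eventually)
      show "((\<lambda>e. (LINT t:{- x..- x+e}|lborel. h (- t)) /\<^sub>R e) \<longlongrightarrow> h x) (at_right 0)"
        using l by (simp add: P_def)
      show "eventually (\<lambda>e. (LINT t:{- x..- x+e}|lborel. h (- t)) /\<^sub>R e = (F x - F (x - e)) /\<^sub>R e) (at_right 0)"
        by (auto simp: eventually_at_right_field Fd set_integral_reflect_real intro!: exI[of _ 1])
    qed
    hence "((\<lambda>e. (F (x + e) - F x) /\<^sub>R e) \<longlongrightarrow> h x) (at_left 0)"
      unfolding at_left_minus filterlim_filtermap minus_zero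
      by (rule Lim_transform_eventually) (auto simp: scaleR_diff_right intro!: always_eventually)
    with r' have "((\<lambda>e. (F (x + e) - F x) /\<^sub>R e) \<longlongrightarrow> h x) (at 0)"
      using filterlim_at_split by blast
    thus "(F has_vector_derivative h x) (at x)"
      by (rule has_vector_derivative_if_limit)
  qed
qed

section \<open>Cube roots of unity and the kernel as an entire function\<close>

lemma zeta_0 [simp]: "zeta 0 = 1"
  by (simp add: zeta_def)

lemma of_real_sqrt3_squared: "complex_of_real (sqrt 3) * complex_of_real (sqrt 3) = 3"
  by (simp flip: of_real_mult)

lemma zeta_1_squared: "zeta (Suc 0) ^ 2 = zeta 2"
  and zeta_2_squared: "zeta 2 ^ 2 = zeta (Suc 0)"
  and zeta_1_mult_2: "zeta (Suc 0) * zeta 2 = 1"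
  and zeta_sum: "1 + zeta (Suc 0) + zeta 2 = 0"
  by (simp_all add: zeta_def power2_eq_square field_simps of_real_sqrt3_squared)

lemma zeta_cube: "zeta k ^ 3 = 1"
proof -
  consider "k = 0" | "k = 1" | "zeta k = zeta 2"
    by (cases "k = 0"; cases "k = 1") (auto simp: zeta_def)
  thus ?thesis
    using zeta_1_squared zeta_2_squared zeta_1_mult_2
    by cases (simp_all add: power3_eq_cube power2_eq_square mult.assoc mult.commute)
qed

lemma norm_zeta: "norm (zeta k) = 1"
proof -
  have "norm (zeta k) ^ 3 = 1" by (simp add: zeta_cube flip: norm_power)
  thus ?thesis using power_eq_imp_eq_base[of "norm (zeta k)" 3 1] by simp
qed

lemma zeta_nonzero [simp]: "zeta k \<noteq> 0"
  using norm_zeta[of k] by force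

lemma zeta_powi_minus_2: "zeta k powi (-2) = zeta k"
  using zeta_cube[of k] by (simp add: power_int_minus field_simps power3_eq_cube power2_eq_square)

text \<open>Exponents count modulo 3, and the three roots sum to zero. Applied to an exponential
  series this filter keeps every third term.\<close>

lemma sum_zeta_power: "(\<Sum>k = 0..2. zeta k ^ n) = (if 3 dvd n then 3 else 0)"
proof -
  have "zeta k ^ n = zeta k ^ (n mod 3)" for k
  proof -
    have "zeta k ^ n = zeta k ^ (3 * (n div 3) + n mod 3)" by simp
    also have "\<dots> = zeta k ^ (n mod 3)" by (simp only: power_add power_mult zeta_cube) simp
    finally show ?thesis .
  qed
  hence "(\<Sum>k = 0..2. zeta k ^ n) = 1 + zeta (Suc 0) ^ (n mod 3) + zeta 2 ^ (n mod 3)"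
    by (simp add: numeral_2_eq_2)
  moreover have "n mod 3 = 0 \<or> n mod 3 = 1 \<or> n mod 3 = 2" by linarith
  ultimately show ?thesis
    using zeta_sum by (auto simp: zeta_1_squared zeta_2_squared add_ac dvd_eq_mod_eq_0)
qed

text \<open>\<open>s2 w / w\<^sup>2\<close> as an entire function; it makes \<open>K1\<close> jointly regular in \<open>l\<close>, including \<open>l = 0\<close>.\<close>

definition s2_quotient_coeff :: "nat \<Rightarrow> complex" where
  "s2_quotient_coeff n = (if 3 dvd n then 1 / fact (n + 2) else 0)"

definition s2_quotient :: "complex \<Rightarrow> complex" where
  "s2_quotient w = (\<Sum>n. s2_quotient_coeff n * w ^ n)"

lemma norm_s2_quotient_coeff_le: "norm (s2_quotient_coeff n) \<le> 1 / fact n"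
proof -
  have "(fact n :: real) \<le> fact (n + 2)" by (rule fact_mono) simp
  thus ?thesis unfolding s2_quotient_coeff_def by (simp add: norm_divide frac_le del: fact_Suc add_2_eq_Suc')
qed

lemma norm_s2_quotient_term_le: "norm (s2_quotient_coeff n * w ^ n) \<le> norm w ^ n /\<^sub>R fact n"
  using mult_right_mono[OF norm_s2_quotient_coeff_le, of "norm w ^ n" n]
  by (simp add: norm_mult norm_power divide_inverse mult.commute)

lemma summable_s2_quotient: "summable (\<lambda>n. s2_quotient_coeff n * w ^ n)"
  by (rule summable_norm_cancel, rule summable_comparison_test'[OF summable_exp_generic[of "norm w"]])
     (use norm_s2_quotient_term_le in simp)

lemma norm_s2_quotient_le: "norm (s2_quotient w) \<le> exp (norm w)"
proof -
  have "norm (s2_quotient w) \<le> (\<Sum>n. norm w ^ n /\<^sub>R fact n)"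
    unfolding s2_quotient_def
    by (intro norm_suminf_le summable_exp_generic norm_s2_quotient_term_le)
  thus ?thesis by (simp add: exp_def)
qed

lemma s2_quotient_has_field_derivative:
  "(s2_quotient has_field_derivative (\<Sum>n. diffs s2_quotient_coeff n * w ^ n)) (at w)"
  unfolding s2_quotient_def
  by (rule termdiffs_strong'[of "norm w + 1"]) (use summable_s2_quotient in auto)

lemma holomorphic_s2_quotient: "s2_quotient holomorphic_on UNIV"
  using s2_quotient_has_field_derivative by (auto simp: holomorphic_on_def field_differentiable_def)

lemma continuous_s2_quotient: "continuous_on UNIV s2_quotient"
  by (rule holomorphic_on_imp_continuous_on[OF holomorphic_s2_quotient])

text \<open>The weights in \<open>s2\<close> equal \<open>zeta k\<close>, so the filter leaves the
  terms w^n / n! for which n + 1 is a multiple of 3. The first of these has n = 2, which lets w^2 be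
  factored out and shifts the index by two.\<close>

lemma s2_eq: "s2 w = w\<^sup>2 * s2_quotient w"
proof -
  have "(\<lambda>n. \<Sum>k = 0..2. zeta k * ((zeta k * w) ^ n /\<^sub>R fact n)) sums (\<Sum>k = 0..2. zeta k * exp (zeta k * w))"
    by (intro sums_sum sums_mult exp_converges)
  hence "(\<lambda>n. (1 / 3) * (\<Sum>k = 0..2. zeta k * ((zeta k * w) ^ n /\<^sub>R fact n))) sums ((1 / 3) * (\<Sum>k = 0..2. zeta k * exp (zeta k * w)))"
    by (rule sums_mult)
  moreover have "(1 / 3) * (\<Sum>k = 0..2. zeta k * exp (zeta k * w)) = s2 w"
    by (simp only: s2_def zeta_powi_minus_2)
  moreover have "(1 / 3) * (\<Sum>k = 0..2. zeta k * ((zeta k * w) ^ n /\<^sub>R fact n)) = (if 3 dvd Suc n then w ^ n / fact n else 0)" for n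
  proof -
    have "(\<Sum>k = 0..2. zeta k * ((zeta k * w) ^ n /\<^sub>R fact n)) = (\<Sum>k = 0..2. zeta k ^ Suc n) * (w ^ n / fact n)"
      unfolding sum_distrib_right
      by (intro sum.cong) (auto simp: power_mult_distrib scaleR_conv_of_real divide_inverse)
    thus ?thesis unfolding sum_zeta_power by simp
  qed
  ultimately have s: "(\<lambda>n. if 3 dvd Suc n then w ^ n / fact n else 0) sums s2 w" by simp
  have "(\<lambda>n. w\<^sup>2 * (s2_quotient_coeff n * w ^ n)) sums (w\<^sup>2 * s2_quotient w)"
    unfolding s2_quotient_def by (intro sums_mult summable_sums summable_s2_quotient)
  also have "(\<lambda>n. w\<^sup>2 * (s2_quotient_coeff n * w ^ n)) = (\<lambda>n. if 3 dvd Suc (n + 2) then w ^ (n + 2) / fact (n + 2) else 0)"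
  proof
    fix n :: nat
    have "3 dvd Suc (n + 2) \<longleftrightarrow> 3 dvd n" by presburger
    thus "w\<^sup>2 * (s2_quotient_coeff n * w ^ n) = (if 3 dvd Suc (n + 2) then w ^ (n + 2) / fact (n + 2) else 0)"
      by (simp add: s2_quotient_coeff_def power_add mult.commute del: fact_Suc add_2_eq_Suc' power_Suc)
  qed
  finally have "(\<lambda>n. if 3 dvd Suc (n + 2) then w ^ (n + 2) / fact (n + 2) else 0) sums (w\<^sup>2 * s2_quotient w)" .
  hence "(\<lambda>n. if 3 dvd Suc n then w ^ n / fact n else 0) sums (w\<^sup>2 * s2_quotient w + (\<Sum>n<2. if 3 dvd Suc n then w ^ n / fact n else 0))"
    by (rule iffD1[OF sums_iff_shift])
  \<comment> \<open>The two terms lost in the shift, n = 0 and n = 1, vanish: neither 1 nor 2 is a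
    multiple of 3.\<close>
  also have "(\<Sum>n<2. if 3 dvd Suc n then w ^ n / fact n else 0) = 0"
  proof -
    have "\<not> 3 dvd Suc (Suc 0)" by presburger
    thus ?thesis by (simp add: numeral_2_eq_2)
  qed
  finally show ?thesis using s sums_unique2 by fastforce
qed

lemma s2_quotient_0: "s2_quotient 0 = 1 / 2"
  unfolding s2_quotient_def powser_zero by (simp add: s2_quotient_coeff_def)

lemma K1_eq: "K1 l x t = of_real (x - t) ^ 2 * s2_quotient (\<i> * l * of_real (x - t))"
  by (simp add: K1_def s2_eq s2_quotient_0 power_mult_distrib)

lemma K1_shift: "K1 l x t = K1 l (x - t) 0"
  by (simp add: K1_eq)

lemma norm_K1_le: "norm (K1 l x t) \<le> (x - t)\<^sup>2 * exp (norm l * \<bar>x - t\<bar>)"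
proof -
  have "norm (K1 l x t) = (x - t)\<^sup>2 * norm (s2_quotient (\<i> * l * of_real (x - t)))"
    unfolding K1_eq norm_mult norm_power norm_of_real by simp
  also have "\<dots> \<le> (x - t)\<^sup>2 * exp (norm (\<i> * l * of_real (x - t)))"
    by (intro mult_left_mono norm_s2_quotient_le) auto
  also have "norm (\<i> * l * of_real (x - t)) = norm l * \<bar>x - t\<bar>"
    unfolding norm_mult norm_of_real by simp
  finally show ?thesis .
qed

text \<open>The quadratic factor is paid for by the gap between \<open>r\<close> and
  \<open>b\<close>: with y = (b - r) (x - t) one has y^2 / 2 \<le> exp y. This is the origin of the
  constant \<open>2 / (b - r)\<^sup>2\<close>, which does not depend on \<open>l\<close>.\<close>

lemma norm_K1_le_exp:
  assumes "norm l \<le> r" "r < b" "t \<le> x"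
  shows "norm (K1 l x t) \<le> 2 / (b - r)\<^sup>2 * exp (b * (x - t))"
proof -
  have "0 \<le> (b - r) * (x - t)" using assms by simp
  from exp_lower_Taylor_quadratic[OF this] this
  have "((b - r) * (x - t))\<^sup>2 / 2 \<le> exp ((b - r) * (x - t))" by linarith
  hence *: "(x - t)\<^sup>2 \<le> 2 / (b - r)\<^sup>2 * exp ((b - r) * (x - t))"
    using assms unfolding power_mult_distrib by (simp add: pos_le_divide_eq mult.commute)
  have "norm (K1 l x t) \<le> (x - t)\<^sup>2 * exp (norm l * \<bar>x - t\<bar>)" by (rule norm_K1_le)
  also have "\<dots> \<le> (x - t)\<^sup>2 * exp (r * (x - t))"
    using assms by (intro mult_left_mono) (auto intro: mult_right_mono)
  also have "\<dots> \<le> (2 / (b - r)\<^sup>2 * exp ((b - r) * (x - t))) * exp (r * (x - t))"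
    by (intro mult_right_mono *) auto
  also have "\<dots> = 2 / (b - r)\<^sup>2 * exp (b * (x - t))"
    by (simp add: mult.assoc algebra_simps flip: exp_add)
  finally show ?thesis .
qed

lemma borel_measurable_K1 [measurable]:
  assumes [measurable]: "f \<in> borel_measurable M" "g \<in> borel_measurable M"
  shows "(\<lambda>p. K1 l (f p) (g p)) \<in> borel_measurable M"
proof -
  have [measurable]: "s2_quotient \<in> borel_measurable borel"
    by (rule borel_measurable_continuous_onI[OF continuous_s2_quotient])
  show ?thesis unfolding K1_eq by measurable
qed

lemma holomorphic_on_K1: "(\<lambda>l. K1 l x t) holomorphic_on S"
proof -
  have "s2_quotient \<circ> (\<lambda>l. \<i> * l * of_real (x - t)) holomorphic_on S"
    by (rule holomorphic_on_compose_gen[OF _ holomorphic_s2_quotient]) (auto intro!: holomorphic_intros)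
  thus ?thesis unfolding K1_eq o_def by (intro holomorphic_intros)
qed

lemma K1_mult_zeta_1: "K1 (l * zeta 1) x t = K1 l x t"
proof -
  have "s2_quotient (w * zeta 1) = s2_quotient w" for w
  proof -
    have "s2_quotient_coeff n * (w * zeta 1) ^ n = s2_quotient_coeff n * w ^ n" for n
    proof (cases "3 dvd n")
      case True
      then obtain m where "n = 3 * m" by blast
      thus ?thesis by (simp only: power_mult_distrib power_mult zeta_cube) simp
    qed (simp add: s2_quotient_coeff_def)
    thus ?thesis by (simp only: s2_quotient_def)
  qed
  from this[of "\<i> * l * of_real (x - t)"] show ?thesis by (simp add: K1_eq mult_ac)
qed

section \<open>Derivatives of the kernel in the space variable\<close>

text \<open>For m = 0, 1, 2 these are the analogues of cosh and sinh for y''' = y: differentiation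
  raises \<open>m\<close> by one, and \<open>m\<close> counts modulo 3. The member with m = 1 is
  \<open>s2\<close>.\<close>

definition zeta_exp_sum :: "nat \<Rightarrow> complex \<Rightarrow> complex" where
  "zeta_exp_sum m z = (1 / 3) * (\<Sum>k = 0..2. zeta k ^ m * exp (zeta k * z))"

lemma zeta_exp_sum_has_field_derivative:
  "(zeta_exp_sum m has_field_derivative zeta_exp_sum (Suc m) z) (at z)"
  unfolding zeta_exp_sum_def
  by (rule derivative_eq_intros DERIV_sum refl)+ (simp add: mult_ac)

lemma zeta_exp_sum_1: "zeta_exp_sum (Suc 0) = s2"
  by (simp add: fun_eq_iff zeta_exp_sum_def s2_def zeta_powi_minus_2)

lemma zeta_exp_sum_add_3: "zeta_exp_sum (m + 3) = zeta_exp_sum m"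
  by (simp add: fun_eq_iff zeta_exp_sum_def power_add zeta_cube)

lemma zeta_exp_sum_0_right: "zeta_exp_sum m 0 = (if 3 dvd m then 1 else 0)"
  by (simp add: zeta_exp_sum_def sum_zeta_power)

lemma norm_zeta_exp_sum_le: "norm (zeta_exp_sum m z) \<le> exp (norm z)"
proof -
  have "norm (\<Sum>k = 0..2. zeta k ^ m * exp (zeta k * z)) \<le> (\<Sum>k = 0..2::nat. exp (norm z))"
  proof (rule sum_norm_le)
    fix k :: nat
    have "norm (exp (zeta k * z)) \<le> exp (norm (zeta k * z))" by (rule norm_exp)
    thus "norm (zeta k ^ m * exp (zeta k * z)) \<le> exp (norm z)"
      by (simp add: norm_mult norm_power norm_zeta)
  qed
  thus ?thesis by (simp add: zeta_exp_sum_def norm_mult)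
qed

definition K1_deriv :: "complex \<Rightarrow> real \<Rightarrow> complex" where
  "K1_deriv l y = (if l = 0 then of_real y else zeta_exp_sum 2 (\<i> * l * of_real y) / (\<i> * l))"

text \<open>Two differentiations have cancelled the denominator \<open>(\<i> * l)\<^sup>2\<close>,
  so \<open>l = 0\<close> fits the same formula. The index 3 acts as 0, which gives the value 1 at
  the origin.\<close>

definition K1_deriv2 :: "complex \<Rightarrow> real \<Rightarrow> complex" where
  "K1_deriv2 l y = zeta_exp_sum 3 (\<i> * l * of_real y)"

lemma zeta_exp_sum_has_vector_derivative:
  "((\<lambda>y. zeta_exp_sum m (c * of_real y)) has_vector_derivative c * zeta_exp_sum (Suc m) (c * of_real y)) (at y)"
proof -
  have "((\<lambda>z. zeta_exp_sum m (c * z)) has_field_derivative zeta_exp_sum (Suc m) (c * of_real y) * c) (at (of_real y))"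
    by (rule DERIV_chain2[OF zeta_exp_sum_has_field_derivative]) (auto intro!: derivative_eq_intros)
  from has_vector_derivative_real_field[OF this] show ?thesis by (simp only: mult.commute)
qed

lemma K1_has_vector_derivative: "((\<lambda>y. K1 l y 0) has_vector_derivative K1_deriv l y) (at y)"
proof (cases "l = 0")
  case True
  have "((\<lambda>z. z\<^sup>2 / 2) has_field_derivative of_real y) (at (of_real y :: complex))"
    by (auto intro!: derivative_eq_intros)
  from has_vector_derivative_real_field[OF this] True show ?thesis
    by (simp add: K1_def K1_deriv_def)
next
  case False
  have "((\<lambda>y. zeta_exp_sum 1 (\<i> * l * of_real y) / (\<i> * l)\<^sup>2) has_vector_derivative
      (\<i> * l * zeta_exp_sum (Suc 1) (\<i> * l * of_real y)) / (\<i> * l)\<^sup>2) (at y)"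
    by (intro has_vector_derivative_divide zeta_exp_sum_has_vector_derivative)
  with False show ?thesis
    by (simp add: K1_def K1_deriv_def zeta_exp_sum_1 power2_eq_square numeral_2_eq_2)
qed

lemma K1_deriv_has_vector_derivative: "(K1_deriv l has_vector_derivative K1_deriv2 l y) (at y)"
proof (cases "l = 0")
  case True
  have "(of_real has_vector_derivative (of_real 1 :: complex)) (at y)"
    by (intro has_vector_derivative_of_real) (auto intro!: derivative_eq_intros)
  moreover have "K1_deriv l = of_real" using True by (simp add: K1_deriv_def fun_eq_iff)
  ultimately show ?thesis using True by (simp add: K1_deriv2_def zeta_exp_sum_0_right)
next
  case False
  have "((\<lambda>y. zeta_exp_sum 2 (\<i> * l * of_real y) / (\<i> * l)) has_vector_derivative
      (\<i> * l * zeta_exp_sum (Suc 2) (\<i> * l * of_real y)) / (\<i> * l)) (at y)"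
    by (intro has_vector_derivative_divide zeta_exp_sum_has_vector_derivative)
  moreover have "K1_deriv l = (\<lambda>y. zeta_exp_sum 2 (\<i> * l * of_real y) / (\<i> * l))"
    using False by (simp add: K1_deriv_def fun_eq_iff)
  ultimately show ?thesis using False
    by (simp add: K1_deriv2_def)
qed

lemma K1_deriv2_has_vector_derivative: "(K1_deriv2 l has_vector_derivative (\<i> * l) ^ 3 * K1 l y 0) (at y)"
proof -
  have "(K1_deriv2 l has_vector_derivative (\<i> * l * zeta_exp_sum (Suc 3) (\<i> * l * of_real y))) (at y)"
    unfolding K1_deriv2_def by (rule zeta_exp_sum_has_vector_derivative)
  moreover have "\<i> * l * zeta_exp_sum (Suc 3) (\<i> * l * of_real y) = (\<i> * l) ^ 3 * K1 l y 0"
    using zeta_exp_sum_add_3[of "Suc 0"]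
    by (simp add: K1_def zeta_exp_sum_1 power3_eq_cube power2_eq_square)
  ultimately show ?thesis by simp
qed

lemma K1_deriv_0: "K1_deriv l 0 = 0" and K1_deriv2_0: "K1_deriv2 l 0 = 1" and K1_diag: "K1 l x x = 0"
  by (simp_all add: K1_deriv_def K1_deriv2_def zeta_exp_sum_0_right K1_eq)

text \<open>The constant may depend on \<open>l\<close>, even like \<open>1 / norm l\<close>: this
  bound serves the differential equation at one fixed \<open>l\<close>, whereas the bound for
  \<open>K1\<close> also has to carry analyticity in \<open>l\<close>.\<close>

lemma norm_K1_deriv_le_exp:
  assumes "norm l < b"
  obtains C where "\<And>y. 0 \<le> y \<Longrightarrow> norm (K1_deriv l y) \<le> C * exp (b * y)"
proof (cases "l = 0")
  case True
  have "norm (K1_deriv l y) \<le> 1 / b * exp (b * y)" if "0 \<le> y" for y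
  proof -
    have "b > 0" "b * y \<le> exp (b * y)"
      using assms True exp_ge_add_one_self[of "b * y"] by (simp, linarith)
    thus ?thesis using that True by (simp add: K1_deriv_def pos_le_divide_eq mult.commute)
  qed
  thus ?thesis by (rule that)
next
  case False
  have "norm (K1_deriv l y) \<le> 1 / norm l * exp (b * y)" if "0 \<le> y" for y
  proof -
    have "norm (zeta_exp_sum 2 (\<i> * l * of_real y)) \<le> exp (norm (\<i> * l * of_real y))"
      by (rule norm_zeta_exp_sum_le)
    also have "\<dots> \<le> exp (b * y)"
      using that assms by (simp add: norm_mult mult_right_mono)
    finally show ?thesis using False
      by (simp add: K1_deriv_def norm_divide norm_mult divide_right_mono)
  qed
  thus ?thesis by (rule that)
qed

lemma norm_K1_deriv2_le_exp:
  assumes "norm l < b" "0 \<le> y"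
  shows "norm (K1_deriv2 l y) \<le> exp (b * y)"
proof -
  have "norm (zeta_exp_sum 3 (\<i> * l * of_real y)) \<le> exp (norm (\<i> * l * of_real y))"
    by (rule norm_zeta_exp_sum_le)
  also have "\<dots> \<le> exp (b * y)"
    using assms by (simp add: norm_mult mult_right_mono)
  finally show ?thesis by (simp add: K1_deriv2_def)
qed

section \<open>Convolutions with the kernel and the differential equation\<close>

lemma continuous_on_if_has_vector_derivative:
  "(\<And>x. (f has_vector_derivative f' x) (at x)) \<Longrightarrow> continuous_on S f"
  by (meson continuous_at_imp_continuous_on has_vector_derivative_continuous)

lemma set_integrable_exp_atMost:
  fixes b :: real
  assumes "b > 0"
  shows "set_integrable lborel {..x} (\<lambda>s. exp (b * s))"
proof -
  define f where "f u = indicator {- x..} u *\<^sub>R exp (- b * u)" for u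
  have "set_integrable lebesgue {- x..} (\<lambda>u. exp (- b * u))"
    by (intro nonnegative_absolutely_integrable_1 integrable_on_exp_minus_to_infinity assms) auto
  hence "integrable lebesgue f"
    by (simp add: set_integrable_def f_def[abs_def])
  moreover have "f \<in> borel_measurable lborel" unfolding f_def by measurable
  ultimately have "integrable lborel f" by (simp add: integrable_completion)
  hence "integrable lborel (\<lambda>s. f (0 + (- 1) * s))"
    by (rule lborel_integrable_real_affine) simp
  moreover have "f (0 + (- 1) * s) = indicator {..x} s *\<^sub>R exp (b * s)" for s
    by (simp add: f_def indicator_def)
  ultimately show ?thesis by (simp add: set_integrable_def)
qed

text \<open>\<open>P (x - t)\<close> is \<open>P 0\<close> plus the integral of
  \<open>p (s - t)\<close> over \<open>s\<close> in \<open>{t..x}\<close>; exchanging the integrals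
  over the triangle leaves the primitive of the convolution with \<open>p\<close>. This replaces
  differentiation under an integral sign with moving endpoint, which an integrand \<open>g\<close>
  that is merely integrable would not allow pointwise.\<close>

lemma convolution_antiderivative:
  fixes P p g :: "real \<Rightarrow> complex"
  assumes P: "\<And>y. (P has_vector_derivative p y) (at y)" and p: "continuous_on UNIV p"
    and bd: "\<And>y. 0 \<le> y \<Longrightarrow> norm (p y) \<le> C * exp (b * y)"
    and b: "b > 0" and g: "g \<in> borel_measurable lborel"
    and gi: "\<And>x. set_integrable lborel {..x} (\<lambda>t. exp (- b * t) * norm (g t))"
  shows "set_integrable lborel {..x} g"
    and "set_integrable lborel {..x} (\<lambda>s. LINT t:{..s}|lborel. p (s - t) * g t)"
    and "(LINT t:{..x}|lborel. P (x - t) * g t) =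
      (LINT t:{..x}|lborel. P 0 * g t) + (LINT s:{..x}|lborel. LINT t:{..s}|lborel. p (s - t) * g t)"
proof -
  have [measurable]: "p \<in> borel_measurable borel" "g \<in> borel_measurable borel"
    using borel_measurable_continuous_onI[OF p] g by auto
  have Gm: "(\<lambda>(s, t). p (s - t) * g t) \<in> borel_measurable (lborel \<Otimes>\<^sub>M lborel)" by measurable
  have w: "set_integrable lborel {..x} (\<lambda>s. C * exp (b * s))"
    by (simp add: set_integrable_exp_atMost b)
  have bd': "norm (p (s - t) * g t) \<le> (C * exp (b * s)) * (exp (- b * t) * norm (g t))" if "t \<le> s" for s t
  proof -
    have "norm (p (s - t) * g t) \<le> C * exp (b * (s - t)) * norm (g t)"
      unfolding norm_mult using bd[of "s - t"] that by (intro mult_right_mono) auto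
    also have "exp (b * (s - t)) = exp (b * s) * exp (- b * t)"
      by (simp add: algebra_simps flip: exp_add)
    finally show ?thesis by (simp add: mult_ac)
  qed
  note tri = Fubini_triangle[OF Gm w gi[of x] bd']
  show "set_integrable lborel {..x} (\<lambda>s. LINT t:{..s}|lborel. p (s - t) * g t)"
    by (rule tri(2))
  show gx: "set_integrable lborel {..x} g"
  proof (rule set_integrable_bound)
    show "set_integrable lborel {..x} (\<lambda>t. exp (b * x) * (exp (- b * t) * norm (g t)))"
      using gi by simp
    show "set_borel_measurable lborel {..x} g" unfolding set_borel_measurable_def by measurable
    show "AE t in lborel. t \<in> {..x} \<longrightarrow> norm (g t) \<le> norm (exp (b * x) * (exp (- b * t) * norm (g t)))"
    proof (intro AE_I2 impI)
      fix t assume "t \<in> {..x}"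
      hence "1 * norm (g t) \<le> exp (b * (x - t)) * norm (g t)"
        using b by (intro mult_right_mono) auto
      thus "norm (g t) \<le> norm (exp (b * x) * (exp (- b * t) * norm (g t)))"
        by (simp add: abs_mult algebra_simps exp_diff exp_minus divide_inverse)
    qed
  qed
  have ftc: "P (x - t) * g t = P 0 * g t + (LINT s:{t..x}|lborel. p (s - t) * g t)" if "t \<le> x" for t
  proof -
    have "(LINT s:{t..x}|lborel. p (s - t)) = P (x - t) - P (t - t)"
      unfolding set_lebesgue_integral_def
    proof (rule integral_FTC_atLeastAtMost[OF that])
      show "((\<lambda>s. P (s - t)) has_vector_derivative p (y - t)) (at y within {t..x})" for y
      proof -
        have "((\<lambda>s. s - t) has_vector_derivative 1) (at y)"
          by (auto intro!: derivative_eq_intros)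
        from vector_diff_chain_at[OF this P[of "y - t"]]
        show ?thesis by (simp add: o_def has_vector_derivative_at_within)
      qed
      show "continuous_on {t..x} (\<lambda>s. p (s - t))"
        by (intro continuous_on_compose2[OF p] continuous_intros) auto
    qed
    hence "P (x - t) = P 0 + (LINT s:{t..x}|lborel. p (s - t))" by simp
    thus ?thesis by (simp add: distrib_right)
  qed
  have "(LINT t:{..x}|lborel. P (x - t) * g t) =
      (LINT t:{..x}|lborel. P 0 * g t + (LINT s:{t..x}|lborel. p (s - t) * g t))"
    by (rule set_lebesgue_integral_cong) (use ftc in auto)
  also have "\<dots> = (LINT t:{..x}|lborel. P 0 * g t) + (LINT t:{..x}|lborel. LINT s:{t..x}|lborel. p (s - t) * g t)"
    by (rule set_integral_add) (use gx tri(3) in auto)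
  finally show "(LINT t:{..x}|lborel. P (x - t) * g t) =
      (LINT t:{..x}|lborel. P 0 * g t) + (LINT s:{..x}|lborel. LINT t:{..s}|lborel. p (s - t) * g t)"
    by (simp only: tri(1))
qed

lemma abs_cont_onD:
  assumes "abs_cont_on c d f" "\<epsilon> > 0"
  obtains \<delta> where "\<delta> > 0" "\<And>x y. c \<le> x \<Longrightarrow> x \<le> y \<Longrightarrow> y \<le> d \<Longrightarrow> y - x < \<delta> \<Longrightarrow> norm (f y - f x) < \<epsilon>"
proof -
  from assms obtain \<delta> where \<delta>: "\<delta> > 0"
    and *: "\<And>(n::nat) (a::nat \<Rightarrow> real) (b::nat \<Rightarrow> real).
        (\<forall>i<n. c \<le> a i \<and> a i \<le> b i \<and> b i \<le> d) \<and>
        disjoint_family_on (\<lambda>i. {a i<..<b i}) {..<n} \<and>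
        (\<Sum>i<n. b i - a i) < \<delta>
        \<longrightarrow> (\<Sum>i<n. norm (f (b i) - f (a i))) < \<epsilon>"
    unfolding abs_cont_on_def by meson
  show ?thesis
  proof (rule that[OF \<delta>])
    fix x y assume "c \<le> x" "x \<le> y" "y \<le> d" "y - x < \<delta>"
    thus "norm (f y - f x) < \<epsilon>"
      using *[of 1 "\<lambda>_. x" "\<lambda>_. y"] by (simp add: disjoint_family_on_def)
  qed
qed

lemma locally_abs_cont_imp_continuous:
  assumes "locally_abs_cont f"
  shows "continuous_on UNIV f"
  unfolding continuous_on_iff
proof (intro ballI allI impI)
  fix x \<epsilon> :: real assume "\<epsilon> > 0"
  have "abs_cont_on (x - 1) (x + 1) f" using assms by (simp add: locally_abs_cont_def)
  from abs_cont_onD[OF this \<open>\<epsilon> > 0\<close>] obtain \<delta> where \<delta>: "\<delta> > 0"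
    and *: "\<And>u v. x - 1 \<le> u \<Longrightarrow> u \<le> v \<Longrightarrow> v \<le> x + 1 \<Longrightarrow> v - u < \<delta> \<Longrightarrow> norm (f v - f u) < \<epsilon>"
    by blast
  show "\<exists>d>0. \<forall>y\<in>UNIV. dist y x < d \<longrightarrow> dist (f y) (f x) < \<epsilon>"
  proof (intro exI[of _ "min \<delta> 1"] conjI ballI impI)
    fix y assume y: "dist y x < min \<delta> 1"
    show "dist (f y) (f x) < \<epsilon>"
    proof (cases "x \<le> y")
      case True
      thus ?thesis using *[of x y] y by (simp add: dist_norm)
    next
      case False
      thus ?thesis using *[of y x] y by (simp add: dist_norm norm_minus_commute)
    qed
  qed (use \<delta> in auto)
qed

lemma abs_cont_on_add:
  assumes "abs_cont_on c d f" "abs_cont_on c d g"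
  shows "abs_cont_on c d (\<lambda>x. f x + g x)"
  unfolding abs_cont_on_def
proof (intro allI impI)
  fix \<epsilon> :: real assume "\<epsilon> > 0"
  hence e: "\<epsilon> / 2 > 0" by simp
  let ?A = "\<lambda>(n::nat) (a::nat \<Rightarrow> real) (b::nat \<Rightarrow> real). (\<forall>i<n. c \<le> a i \<and> a i \<le> b i \<and> b i \<le> d) \<and>
        disjoint_family_on (\<lambda>i. {a i<..<b i}) {..<n}"
  obtain \<delta>1 where 1: "\<delta>1 > 0" "\<And>n a b. ?A n a b \<and> (\<Sum>i<n. b i - a i) < \<delta>1 \<Longrightarrow> (\<Sum>i<n. norm (f (b i) - f (a i))) < \<epsilon> / 2"
    using assms(1) e unfolding abs_cont_on_def by meson
  obtain \<delta>2 where 2: "\<delta>2 > 0" "\<And>n a b. ?A n a b \<and> (\<Sum>i<n. b i - a i) < \<delta>2 \<Longrightarrow> (\<Sum>i<n. norm (g (b i) - g (a i))) < \<epsilon> / 2"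
    using assms(2) e unfolding abs_cont_on_def by meson
  show "\<exists>\<delta>>0. \<forall>(n::nat) (a::nat \<Rightarrow> real) (b::nat \<Rightarrow> real).
        (\<forall>i<n. c \<le> a i \<and> a i \<le> b i \<and> b i \<le> d) \<and>
        disjoint_family_on (\<lambda>i. {a i<..<b i}) {..<n} \<and>
        (\<Sum>i<n. b i - a i) < \<delta>
        \<longrightarrow> (\<Sum>i<n. norm (f (b i) + g (b i) - (f (a i) + g (a i)))) < \<epsilon>"
  proof (intro exI[of _ "min \<delta>1 \<delta>2"] conjI allI impI)
    show "min \<delta>1 \<delta>2 > 0" using 1(1) 2(1) by simp
    fix n :: nat and a b :: "nat \<Rightarrow> real"
    assume *: "(\<forall>i<n. c \<le> a i \<and> a i \<le> b i \<and> b i \<le> d) \<and>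
        disjoint_family_on (\<lambda>i. {a i<..<b i}) {..<n} \<and> (\<Sum>i<n. b i - a i) < min \<delta>1 \<delta>2"
    have "(\<Sum>i<n. norm (f (b i) + g (b i) - (f (a i) + g (a i)))) \<le>
        (\<Sum>i<n. norm (f (b i) - f (a i)) + norm (g (b i) - g (a i)))"
      by (intro sum_mono) (simp add: add_diff_add norm_triangle_ineq)
    also have "\<dots> = (\<Sum>i<n. norm (f (b i) - f (a i))) + (\<Sum>i<n. norm (g (b i) - g (a i)))"
      by (rule sum.distrib)
    also have "\<dots> < \<epsilon> / 2 + \<epsilon> / 2"
      using 1(2)[of n a b] 2(2)[of n a b] * by (intro add_strict_mono) simp_all
    finally show "(\<Sum>i<n. norm (f (b i) + g (b i) - (f (a i) + g (a i)))) < \<epsilon>" by simp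
  qed
qed

text \<open>A bound for \<open>f'\<close> on the compact interval makes \<open>f\<close> Lipschitz
  there. This serves the plane wave part of the solution.\<close>

lemma abs_cont_on_C1:
  fixes f :: "real \<Rightarrow> complex"
  assumes f: "\<And>x. (f has_vector_derivative f' x) (at x)" and f': "continuous_on UNIV f'"
  shows "abs_cont_on c d f"
  unfolding abs_cont_on_def
proof (intro allI impI)
  fix \<epsilon> :: real assume "\<epsilon> > 0"
  have "bounded (f' ` {c..d})"
    by (intro compact_imp_bounded compact_continuous_image continuous_on_subset[OF f']) auto
  then obtain B where B: "B > 0" "\<And>x. x \<in> {c..d} \<Longrightarrow> norm (f' x) \<le> B"
    by (auto simp: bounded_pos)
  have lip: "norm (f y - f x) \<le> B * (y - x)" if "c \<le> x" "x \<le> y" "y \<le> d" for x y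
  proof -
    have "norm (f y - f x) \<le> B * norm (y - x)"
    proof (rule differentiable_bound[of "{c..d}" f "\<lambda>x h. h *\<^sub>R f' x"])
      show "(f has_derivative (\<lambda>h. h *\<^sub>R f' x)) (at x within {c..d})" for x
        using f[of x] by (simp add: has_vector_derivative_def has_derivative_at_withinI)
      show "onorm (\<lambda>h. h *\<^sub>R f' x) \<le> B" if "x \<in> {c..d}" for x
        by (rule onorm_le) (use B(2)[OF that] in \<open>auto simp: mult.commute[of B] intro: mult_left_mono\<close>)
    qed (use that in auto)
    thus ?thesis using that by simp
  qed
  show "\<exists>\<delta>>0. \<forall>(n::nat) (a::nat \<Rightarrow> real) (b::nat \<Rightarrow> real).
        (\<forall>i<n. c \<le> a i \<and> a i \<le> b i \<and> b i \<le> d) \<and>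
        disjoint_family_on (\<lambda>i. {a i<..<b i}) {..<n} \<and>
        (\<Sum>i<n. b i - a i) < \<delta>
        \<longrightarrow> (\<Sum>i<n. norm (f (b i) - f (a i))) < \<epsilon>"
  proof (intro exI[of _ "\<epsilon> / B"] conjI allI impI)
    show "\<epsilon> / B > 0" using \<open>\<epsilon> > 0\<close> B by simp
    fix n :: nat and a b :: "nat \<Rightarrow> real"
    assume *: "(\<forall>i<n. c \<le> a i \<and> a i \<le> b i \<and> b i \<le> d) \<and>
        disjoint_family_on (\<lambda>i. {a i<..<b i}) {..<n} \<and> (\<Sum>i<n. b i - a i) < \<epsilon> / B"
    have "(\<Sum>i<n. norm (f (b i) - f (a i))) \<le> (\<Sum>i<n. B * (b i - a i))"
      by (intro sum_mono lip) (use * in auto)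
    also have "\<dots> = B * (\<Sum>i<n. b i - a i)" by (simp add: sum_distrib_left)
    also have "\<dots> < \<epsilon>" using * B by (simp add: pos_less_divide_eq mult.commute)
    finally show "(\<Sum>i<n. norm (f (b i) - f (a i))) < \<epsilon>" .
  qed
qed

lemma locally_abs_cont_integral:
  fixes h :: "real \<Rightarrow> complex"
  assumes "\<And>d. set_integrable lborel {..d} h"
  shows "locally_abs_cont (\<lambda>x. LINT t:{..x}|lborel. h t)"
  unfolding locally_abs_cont_def
  using abs_cont_on_integral[where C = 0 and F = "\<lambda>x. LINT t:{..x}|lborel. h t", OF assms] by simp

lemma has_vector_derivative_integral_atMost:
  fixes h :: "real \<Rightarrow> complex"
  assumes h: "\<And>d. set_integrable lborel {..d} h" and c: "continuous_on UNIV h"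
  shows "((\<lambda>x. LINT t:{..x}|lborel. h t) has_vector_derivative h x) (at x)"
proof -
  let ?F = "\<lambda>x. LINT t:{..x}|lborel. h t"
  \<comment> \<open>Differentiability at \<open>x\<close> is local, so the half-line is cut at
    \<open>x - 1\<close>; the part below contributes a constant.\<close>
  have "((\<lambda>u. integral {x - 1..u} h) has_vector_derivative h x) (at x within {x - 1..x + 1})"
    by (rule integral_has_vector_derivative) (auto intro: continuous_on_subset[OF c])
  hence "((\<lambda>u. integral {x - 1..u} h) has_vector_derivative h x) (at x)"
    by (simp add: at_within_Icc_at)
  hence "((\<lambda>u. ?F (x - 1) + integral {x - 1..u} h) has_vector_derivative h x) (at x)"
    using has_vector_derivative_add[OF has_vector_derivative_const] by fastforce
  thus ?thesis
  proof (rule has_vector_derivative_transform_within_open[of _ _ _ "{x - 1<..<x + 1}"])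
    fix u assume "u \<in> {x - 1<..<x + 1}"
    hence u: "x - 1 \<le> u" by simp
    have hi: "set_integrable lborel {x - 1..u} h"
      by (rule set_integrable_subset[OF h[of u]]) auto
    have "?F u - ?F (x - 1) = (LINT t:{x - 1<..u}|lborel. h t)"
      by (rule set_integral_atMost_diff[OF h u order.refl])
    also have "\<dots> = (LINT t:{x - 1..u}|lborel. h t)"
      by (rule set_integral_interval_endpoints(1)[OF hi])
    also have "\<dots> = integral {x - 1..u} h"
      by (rule set_borel_integral_eq_integral(2)[OF hi])
    finally show "?F (x - 1) + integral {x - 1..u} h = ?F u" by (simp add: algebra_simps)
  qed auto
qed

text \<open>The convolutions \<open>F0\<close>, \<open>F1\<close>, \<open>F2\<close> of
  \<open>g\<close> with the kernel and its first two derivatives are successive primitives. The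
  values at the origin 0, 0, 1 are those of a fundamental solution: boundary terms are absent twice,
  and the third one is \<open>g\<close> itself, which brings in the potential.\<close>

lemma solves_ode_if_Volterra:
  fixes u :: "real \<Rightarrow> complex" and q :: "real \<Rightarrow> real"
  assumes l: "norm l < b" and \<omega>: "\<omega> ^ 3 = 1"
    and m: "(\<lambda>t. of_real (q t) * u t) \<in> borel_measurable lborel"
    and gi: "\<And>x. set_integrable lborel {..x} (\<lambda>t. exp (- b * t) * norm (of_real (q t) * u t))"
    and u: "\<And>x. u x = exp (\<i> * l * \<omega> * of_real x) + \<i> * (LINT t:{..x}|lborel. K1 l x t * (of_real (q t) * u t))"
  shows "solves_ode q l u"
proof -
  have b: "b > 0" using l norm_ge_zero[of l] by linarith
  define g where "g t = \<i> * (of_real (q t) * u t)" for t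
  define c where "c = \<i> * l * \<omega>"
  define f where "f x = exp (c * of_real x)" for x :: real
  define F0 where "F0 x = (LINT t:{..x}|lborel. K1 l (x - t) 0 * g t)" for x
  define F1 where "F1 x = (LINT t:{..x}|lborel. K1_deriv l (x - t) * g t)" for x
  define F2 where "F2 x = (LINT t:{..x}|lborel. K1_deriv2 l (x - t) * g t)" for x
  have gm: "g \<in> borel_measurable lborel" using m unfolding g_def by measurable
  have gi': "set_integrable lborel {..x} (\<lambda>t. exp (- b * t) * norm (g t))" for x
    using gi[of x] by (simp add: g_def norm_mult)
  have c3: "c ^ 3 = (\<i> * l) ^ 3" by (simp add: c_def power_mult_distrib \<omega>)
  have k0c: "continuous_on UNIV (\<lambda>y. K1 l y 0)" and k1c: "continuous_on UNIV (K1_deriv l)"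
    and k2c: "continuous_on UNIV (K1_deriv2 l)"
    by (rule continuous_on_if_has_vector_derivative, rule K1_has_vector_derivative K1_deriv_has_vector_derivative K1_deriv2_has_vector_derivative)+
  have "norm (K1 l y 0) \<le> 2 / (b - norm l)\<^sup>2 * exp (b * y)" if "0 \<le> y" for y
    using norm_K1_le_exp[OF order.refl l that] by simp
  hence k0b: "norm ((\<i> * l) ^ 3 * K1 l y 0) \<le> (norm l ^ 3 * (2 / (b - norm l)\<^sup>2)) * exp (b * y)" if "0 \<le> y" for y
    using that unfolding norm_mult norm_power mult.assoc by (intro mult_mono) auto
  obtain C1 where k1b: "\<And>y. 0 \<le> y \<Longrightarrow> norm (K1_deriv l y) \<le> C1 * exp (b * y)"
    using norm_K1_deriv_le_exp[OF l] by blast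
  have k2b: "norm (K1_deriv2 l y) \<le> 1 * exp (b * y)" if "0 \<le> y" for y
    using norm_K1_deriv2_le_exp[OF l that] by simp
  note A0 = convolution_antiderivative[OF K1_has_vector_derivative k1c k1b b gm gi']
  note A1 = convolution_antiderivative[OF K1_deriv_has_vector_derivative k2c k2b b gm gi']
  note A2 = convolution_antiderivative[OF K1_deriv2_has_vector_derivative continuous_on_mult[OF continuous_on_const k0c] k0b b gm gi']
  have i1: "set_integrable lborel {..x} F1" and F0: "F0 x = (LINT s:{..x}|lborel. F1 s)" for x
    using A0(2)[of x] A0(3)[of x] unfolding F0_def F1_def K1_diag by simp_all
  have i2: "set_integrable lborel {..x} F2" and F1: "F1 x = (LINT s:{..x}|lborel. F2 s)" for x
    using A1(2)[of x] A1(3)[of x] unfolding F1_def F2_def K1_deriv_0 by simp_all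
  have i3: "set_integrable lborel {..x} (\<lambda>s. g s + (\<i> * l) ^ 3 * F0 s)"
    and F2: "F2 x = (LINT s:{..x}|lborel. g s + (\<i> * l) ^ 3 * F0 s)" for x
  proof -
    have i: "set_integrable lborel {..x} g" "set_integrable lborel {..x} (\<lambda>s. (\<i> * l) ^ 3 * F0 s)"
      using A2(1,2)[of x] unfolding F0_def mult.assoc by simp_all
    thus "set_integrable lborel {..x} (\<lambda>s. g s + (\<i> * l) ^ 3 * F0 s)" by (rule set_integral_add)
    have "F2 x = (LINT s:{..x}|lborel. g s) + (LINT s:{..x}|lborel. (\<i> * l) ^ 3 * F0 s)"
      using A2(3)[of x] unfolding F2_def F0_def K1_deriv2_0 mult.assoc by simp
    thus "F2 x = (LINT s:{..x}|lborel. g s + (\<i> * l) ^ 3 * F0 s)"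
      using set_integral_add(2)[OF i] by simp
  qed
  \<comment> \<open>Regularity is gained from the top: \<open>F2\<close> is an integral, hence
    absolutely continuous and continuous; so \<open>F1\<close> is differentiable at every point,
    hence continuous; and then so is \<open>F0\<close>.\<close>
  have F2ac: "locally_abs_cont F2"
    unfolding F2[abs_def] by (rule locally_abs_cont_integral[OF i3])
  have F1d: "(F1 has_vector_derivative F2 x) (at x)" for x
    unfolding F1[abs_def]
    by (rule has_vector_derivative_integral_atMost[OF i2 locally_abs_cont_imp_continuous[OF F2ac]])
  have F0d: "(F0 has_vector_derivative F1 x) (at x)" for x
    unfolding F0[abs_def]
    by (rule has_vector_derivative_integral_atMost[OF i1 continuous_on_if_has_vector_derivative[OF F1d]])
  have F2d: "AE x in lebesgue. (F2 has_vector_derivative g x + (\<i> * l) ^ 3 * F0 x) (at x)"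
    by (rule AE_has_vector_derivative_integral[where C = 0, OF i3]) (simp add: F2)
  have fd: "((\<lambda>x. a * f x) has_vector_derivative a * c * f x) (at x)" for a x
    unfolding f_def
    by (rule has_vector_derivative_real_field) (auto intro!: derivative_eq_intros)
  have uf: "u x = f x + F0 x" for x
    unfolding u[of x] f_def c_def F0_def g_def K1_shift[of l x]
    unfolding set_integral_mult_right[symmetric] by (simp only: mult.left_commute)
  define u1 where "u1 x = c * f x + F1 x" for x
  define u2 where "u2 x = c * c * f x + F2 x" for x
  have "(u has_vector_derivative u1 x) (at x)" for x
    unfolding uf[abs_def] u1_def using fd[of 1] by (auto intro!: has_vector_derivative_add F0d)
  moreover have "(u1 has_vector_derivative u2 x) (at x)" for x
    unfolding u1_def[abs_def] u2_def using fd[of c] by (auto intro!: has_vector_derivative_add F1d)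
  moreover have "locally_abs_cont u2"
    unfolding locally_abs_cont_def u2_def
  proof (intro allI impI abs_cont_on_add)
    fix a d :: real assume "a < d"
    thus "abs_cont_on a d F2" using F2ac by (simp add: locally_abs_cont_def)
    show "abs_cont_on a d (\<lambda>x. c * c * f x)"
      by (rule abs_cont_on_C1[OF fd]) (rule continuous_on_if_has_vector_derivative[OF fd])
  qed
  moreover have "AE x in lebesgue. \<exists>y3. (u2 has_vector_derivative y3) (at x) \<and>
                 \<i> * y3 + of_real (q x) * u x = l ^ 3 * u x"
    using F2d
  proof eventually_elim
    fix x assume d: "(F2 has_vector_derivative g x + (\<i> * l) ^ 3 * F0 x) (at x)"
    let ?y = "c * c * c * f x + (g x + (\<i> * l) ^ 3 * F0 x)"
    have "?y = (\<i> * l) ^ 3 * u x + g x"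
      using c3 by (simp add: uf power3_eq_cube algebra_simps)
    moreover have "(u2 has_vector_derivative ?y) (at x)"
      unfolding u2_def[abs_def] by (intro has_vector_derivative_add fd d)
    ultimately have "(u2 has_vector_derivative (\<i> * l) ^ 3 * u x + g x) (at x)"
      by (simp only:)
    \<comment> \<open>Since \<open>\<i> * (\<i> * l) ^ 3 = l ^ 3\<close> and
      \<open>\<i> * g x = - of_real (q x) * u x\<close>, the potential terms cancel.\<close>
    moreover have "\<i> * ((\<i> * l) ^ 3 * u x + g x) + of_real (q x) * u x = l ^ 3 * u x"
      by (simp add: g_def power_mult_distrib power3_eq_cube algebra_simps)
    ultimately show "\<exists>y3. (u2 has_vector_derivative y3) (at x) \<and> \<i> * y3 + of_real (q x) * u x = l ^ 3 * u x"
      by blast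
  qed
  ultimately show ?thesis unfolding solves_ode_def by blast
qed

text \<open>
  The weight is \<open>W s = exp (B (pi/2 - arctan s))\<close>, whose derivative is \<open>- B W s / (1 + s\<^sup>2)\<close>:
  split \<open>\<bar>q\<bar>\<close> by AM-GM into a small multiple of \<open>q\<^sup>2 (1 + s\<^sup>2)\<close>, controlled since \<open>W\<close> decreases, and
  a large multiple of \<open>1 / (1 + s\<^sup>2)\<close>, integrated exactly and made small by large \<open>B\<close>.
\<close>

lemma exists_absorbing_weight:
  fixes q :: "real \<Rightarrow> real" and C :: real
  assumes C: "C > 0" and q [measurable]: "q \<in> borel_measurable borel"
    and q2: "integrable lborel (\<lambda>s. (q s)\<^sup>2 * (1 + s\<^sup>2))"
  obtains W :: "real \<Rightarrow> real" and M where "W \<in> borel_measurable borel"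
    "\<And>s. 1 \<le> W s" "\<And>s. W s \<le> M"
    "\<And>t x. t \<le> x \<Longrightarrow> C * (LINT s:{t..x}|lborel. \<bar>q s\<bar> * W s) \<le> W t / 2"
proof -
  define Q where "Q = (LINT s|lborel. (q s)\<^sup>2 * (1 + s\<^sup>2))"
  have Q: "Q \<ge> 0" unfolding Q_def by (intro integral_nonneg_AE) auto
  \<comment> \<open>The factor 1/2 in the conclusion is shared equally by the two terms of the
    splitting: \<open>\<eta>\<close> makes \<open>C * \<eta> * Q / 2\<close> at most 1/4, with
    \<open>Q + 1\<close> guarding against \<open>Q = 0\<close>, and \<open>B\<close> makes
    \<open>C / (2 * \<eta> * B)\<close> equal to 1/4.\<close>
  define \<eta> where "\<eta> = 1 / (2 * C * (Q + 1))"
  define B where "B = 2 * C / \<eta>"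
  have \<eta>: "\<eta> > 0" using C Q by (simp add: \<eta>_def)
  have B: "B > 0" using C \<eta> by (simp add: B_def)
  define W where "W s = exp (B * (pi / 2 - arctan s))" for s
  have Wm [measurable]: "W \<in> borel_measurable borel"
    unfolding W_def by measurable
  have W1: "1 \<le> W s" for s
    using arctan_ubound[of s] B by (simp add: W_def)
  have WM: "W s \<le> exp (B * pi)" for s
    using arctan_lbound[of s] B by (simp add: W_def)
  have Wmono: "W s \<le> W t" if "t \<le> s" for s t
    using that B by (simp add: W_def arctan_le_iff)
  have Wd: "((\<lambda>s. - W s / B) has_real_derivative W s / (1 + s\<^sup>2)) (at s)" for s
    unfolding W_def using B
    by (auto intro!: derivative_eq_intros simp: field_simps add_nonneg_eq_0_iff)
  have "C * (LINT s:{t..x}|lborel. \<bar>q s\<bar> * W s) \<le> W t / 2" if "t \<le> x" for t x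
  proof -
    let ?f1 = "\<lambda>s. (q s)\<^sup>2 * (1 + s\<^sup>2)" and ?f2 = "\<lambda>s. W s / (1 + s\<^sup>2)"
    have cont: "continuous_on {t..x} ?f2"
      unfolding W_def by (intro continuous_intros) (auto simp: add_nonneg_eq_0_iff)
    have i2: "set_integrable lborel {t..x} ?f2"
      by (rule borel_integrable_atLeastAtMost'[OF cont])
    have I2: "(LINT s:{t..x}|lborel. ?f2 s) = - W x / B - (- W t / B)"
      unfolding set_lebesgue_integral_def
    proof (rule integral_FTC_atLeastAtMost[OF that _ cont])
      show "((\<lambda>s. - W s / B) has_vector_derivative W s / (1 + s\<^sup>2)) (at s within {t..x})" for s
        using Wd[of s] by (simp add: has_real_derivative_iff_has_vector_derivative has_vector_derivative_at_within)
    qed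
    also have "\<dots> \<le> W t / B" using W1[of x] B by simp
    finally have I2: "(LINT s:{t..x}|lborel. ?f2 s) \<le> W t / B" .
    have i1: "set_integrable lborel {t..x} ?f1"
      using integrable_mult_indicator[OF _ q2, of "{t..x}"] by (simp add: set_integrable_def)
    have "(LINT s:{t..x}|lborel. ?f1 s) \<le> Q"
      unfolding set_lebesgue_integral_def Q_def
      by (rule integral_mono) (use i1 q2 in \<open>auto simp: set_integrable_def indicator_def\<close>)
    hence I1: "\<eta> / 2 * W t * (LINT s:{t..x}|lborel. ?f1 s) \<le> \<eta> / 2 * W t * Q"
      using \<eta> W1[of t] by (intro mult_left_mono) auto
    have pt: "\<bar>q s\<bar> * W s \<le> \<eta> / 2 * W t * ?f1 s + 1 / (2 * \<eta>) * ?f2 s" if s: "s \<in> {t..x}" for s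
    proof -
      have p: "1 + s\<^sup>2 > 0" by (simp add: add_pos_nonneg)
      have alg: "((\<eta> * D * a)\<^sup>2 + 1) / (2 * \<eta> * D) = \<eta> / 2 * (a\<^sup>2 * D) + 1 / (2 * \<eta>) * (1 / D)"
        if "D > 0" for a D :: real
        using that \<eta> by (simp add: field_simps power2_eq_square)
      have "0 \<le> (\<eta> * (1 + s\<^sup>2) * \<bar>q s\<bar> - 1)\<^sup>2" by simp
      hence "2 * (\<eta> * (1 + s\<^sup>2) * \<bar>q s\<bar>) \<le> (\<eta> * (1 + s\<^sup>2) * \<bar>q s\<bar>)\<^sup>2 + 1"
        by (simp add: power2_eq_square algebra_simps)
      hence "\<bar>q s\<bar> \<le> ((\<eta> * (1 + s\<^sup>2) * \<bar>q s\<bar>)\<^sup>2 + 1) / (2 * \<eta> * (1 + s\<^sup>2))"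
        using p \<eta> by (simp add: pos_le_divide_eq mult_ac)
      also have "\<dots> = \<eta> / 2 * ?f1 s + 1 / (2 * \<eta>) * (1 / (1 + s\<^sup>2))"
        using alg[OF p, of "\<bar>q s\<bar>"] by simp
      finally have "\<bar>q s\<bar> * W s \<le> (\<eta> / 2 * ?f1 s + 1 / (2 * \<eta>) * (1 / (1 + s\<^sup>2))) * W s"
        using W1[of s] by (intro mult_right_mono) auto
      also have "\<dots> = \<eta> / 2 * W s * ?f1 s + 1 / (2 * \<eta>) * ?f2 s"
        by (simp add: algebra_simps)
      also have "\<eta> / 2 * W s * ?f1 s \<le> \<eta> / 2 * W t * ?f1 s"
        using \<eta> Wmono[of t s] s by (intro mult_right_mono mult_left_mono) auto
      finally show ?thesis by simp
    qed
    have "(LINT s:{t..x}|lborel. \<bar>q s\<bar> * W s) \<le> (LINT s:{t..x}|lborel. \<eta> / 2 * W t * ?f1 s + 1 / (2 * \<eta>) * ?f2 s)"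
    proof (rule set_integral_mono[OF _ _ pt])
      show *: "set_integrable lborel {t..x} (\<lambda>s. \<eta> / 2 * W t * ?f1 s + 1 / (2 * \<eta>) * ?f2 s)"
        by (intro set_integral_add set_integrable_mult_right) (use i1 i2 in auto)
      show "set_integrable lborel {t..x} (\<lambda>s. \<bar>q s\<bar> * W s)"
      proof (rule set_integrable_bound[OF *])
        show "set_borel_measurable lborel {t..x} (\<lambda>s. \<bar>q s\<bar> * W s)"
          unfolding set_borel_measurable_def by measurable
        show "AE s in lborel. s \<in> {t..x} \<longrightarrow> norm (\<bar>q s\<bar> * W s) \<le> norm (\<eta> / 2 * W t * ?f1 s + 1 / (2 * \<eta>) * ?f2 s)"
        proof (intro AE_I2 impI)
          fix s assume "s \<in> {t..x}"
          from pt[OF this] W1[of s] show "norm (\<bar>q s\<bar> * W s) \<le> norm (\<eta> / 2 * W t * ?f1 s + 1 / (2 * \<eta>) * ?f2 s)"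
            by (simp add: abs_mult)
        qed
      qed
    qed
    also have "\<dots> = \<eta> / 2 * W t * (LINT s:{t..x}|lborel. ?f1 s) + 1 / (2 * \<eta>) * (LINT s:{t..x}|lborel. ?f2 s)"
      by (simp only: set_integral_add(2) set_integral_mult_right set_integrable_mult_right i1 i2)
    also have "\<dots> \<le> \<eta> / 2 * W t * Q + 1 / (2 * \<eta>) * (W t / B)"
      by (rule add_mono[OF I1 mult_left_mono[OF I2]]) (use \<eta> in simp)
    finally have "C * (LINT s:{t..x}|lborel. \<bar>q s\<bar> * W s) \<le> C * (\<eta> / 2 * W t * Q + 1 / (2 * \<eta>) * (W t / B))"
      using C by (intro mult_left_mono) auto
    also have "\<dots> = W t * (C * \<eta> * Q / 2 + C / (2 * \<eta> * B))"
      by (simp add: algebra_simps)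
    also have "\<dots> \<le> W t * (1 / 4 + 1 / 4)"
    proof (intro mult_left_mono add_mono)
      have "C * \<eta> = 1 / (2 * (Q + 1))" using C by (simp add: \<eta>_def)
      hence "C * \<eta> * Q / 2 = Q / (Q + 1) / 4" by simp
      also have "\<dots> \<le> 1 / 4" using Q by simp
      finally show "C * \<eta> * Q / 2 \<le> 1 / 4" .
      show "C / (2 * \<eta> * B) \<le> 1 / 4" using C \<eta> by (simp add: B_def)
      show "0 \<le> W t" using W1[of t] by simp
    qed
    finally show ?thesis by simp
  qed
  with Wm W1 WM show ?thesis by (rule that)
qed

section \<open>Measurability, bounds and analyticity of the iterated kernels\<close>

text \<open>\<open>Khat\<close> integrates over Lebesgue measure, while products and Fubini are
  handled over Borel sets; for Borel integrands the two integrals agree.\<close>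

lemma Khat_Suc_lborel:
  assumes [measurable]: "q \<in> borel_measurable borel" "(\<lambda>s. Khat q n l x s) \<in> borel_measurable borel"
  shows "Khat q (Suc n) l x t = (LINT s:{t..x}|lborel. Khat q n l x s * of_real (q s) * K1 l s t)"
  unfolding Khat.simps set_lebesgue_integral_def
  by (rule integral_completion) measurable

text \<open>The recursion keeps \<open>x\<close> fixed and integrates over the last argument, so
  measurability in that argument alone is inductive. The moving interval becomes a condition on the
  pair \<open>(t, s)\<close>.\<close>

lemma borel_measurable_Khat:
  assumes q [measurable]: "q \<in> borel_measurable borel"
  shows "(\<lambda>s. Khat q n l x s) \<in> borel_measurable borel"
proof (induction n)
  case (Suc n)
  note [measurable] = Suc
  have "Measurable.pred (borel \<Otimes>\<^sub>M lborel) (\<lambda>p::real \<times> real. snd p \<in> {fst p..x})"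
    unfolding atLeastAtMost_iff by measurable
  hence "(\<lambda>p::real \<times> real. if snd p \<in> {fst p..x} then Khat q n l x (snd p) * of_real (q (snd p)) * K1 l (snd p) (fst p) else 0)
      \<in> borel_measurable (borel \<Otimes>\<^sub>M lborel)"
    by measurable
  also have "(\<lambda>p::real \<times> real. if snd p \<in> {fst p..x} then Khat q n l x (snd p) * of_real (q (snd p)) * K1 l (snd p) (fst p) else 0)
      = (\<lambda>(t, s). indicator {t..x} s *\<^sub>R (Khat q n l x s * of_real (q s) * K1 l s t))"
    by (auto simp: fun_eq_iff indicator_def)
  finally have "(\<lambda>t. LINT s|lborel. indicator {t..x} s *\<^sub>R (Khat q n l x s * of_real (q s) * K1 l s t)) \<in> borel_measurable borel"
    by (rule lborel.borel_measurable_lebesgue_integral)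
  thus ?case
    unfolding Khat_Suc_lborel[OF q Suc] set_lebesgue_integral_def .
qed simp

text \<open>The geometric majorant yields both requirements for exchanging sum and integral:
  absolute convergence at each point and summability of the integrals of the norms.\<close>

lemma set_integral_suminf:
  fixes f :: "nat \<Rightarrow> real \<Rightarrow> complex" and w :: "real \<Rightarrow> real"
  assumes m: "\<And>n. set_borel_measurable lborel A (f n)"
    and w: "set_integrable lborel A w"
    and bd: "\<And>n t. t \<in> A \<Longrightarrow> norm (f n t) \<le> (1 / 2) ^ n * w t"
  shows "set_integrable lborel A (\<lambda>t. \<Sum>n. f n t)"
    and "(LINT t:A|lborel. \<Sum>n. f n t) = (\<Sum>n. LINT t:A|lborel. f n t)"
proof -
  define F where "F n t = indicator A t *\<^sub>R f n t" for n t
  define v where "v t = indicator A t *\<^sub>R w t" for t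
  have v: "integrable lborel v" using w by (simp add: v_def[abs_def] set_integrable_def)
  have bd': "norm (F n t) \<le> (1 / 2) ^ n * v t" for n t
    using bd[of t n] by (auto simp: F_def v_def indicator_def)
  have vn: "integrable lborel (\<lambda>t. (1 / 2) ^ n * v t)" for n using v by simp
  have int: "integrable lborel (F n)" for n
  proof (rule Bochner_Integration.integrable_bound[OF vn])
    show "F n \<in> borel_measurable lborel" using m[of n] by (simp add: F_def[abs_def] set_borel_measurable_def)
    show "AE t in lborel. norm (F n t) \<le> norm ((1 / 2) ^ n * v t)"
    proof (rule AE_I2)
      fix t show "norm (F n t) \<le> norm ((1 / 2) ^ n * v t)"
        using bd'[of n t] abs_ge_self[of "(1 / 2) ^ n * v t"] by simp
    qed
  qed
  have s1: "AE t in lborel. summable (\<lambda>n. norm (F n t))"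
  proof (rule AE_I2)
    fix t show "summable (\<lambda>n. norm (F n t))"
      by (rule summable_comparison_test'[of "\<lambda>n. (1 / 2) ^ n * v t"])
         (use bd' in \<open>auto intro!: summable_mult2 summable_geometric\<close>)
  qed
  have s2: "summable (\<lambda>n. LINT t|lborel. norm (F n t))"
  proof (rule summable_comparison_test'[of "\<lambda>n. (1 / 2) ^ n * (LINT t|lborel. v t)"])
    show "summable (\<lambda>n. (1 / 2) ^ n * (LINT t|lborel. v t))"
      by (intro summable_mult2 summable_geometric) simp
    fix n :: nat
    have "(LINT t|lborel. norm (F n t)) \<le> (LINT t|lborel. (1 / 2) ^ n * v t)"
      by (rule integral_mono) (use int vn bd' in auto)
    thus "norm (LINT t|lborel. norm (F n t)) \<le> (1 / 2) ^ n * (LINT t|lborel. v t)"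
      by (simp add: integral_nonneg_AE)
  qed
  have eq: "(\<Sum>n. F n t) = indicator A t *\<^sub>R (\<Sum>n. f n t)" for t
    by (simp add: F_def indicator_def)
  show "set_integrable lborel A (\<lambda>t. \<Sum>n. f n t)"
    using integrable_suminf[OF int s1 s2] by (simp add: set_integrable_def eq)
  show "(LINT t:A|lborel. \<Sum>n. f n t) = (\<Sum>n. LINT t:A|lborel. f n t)"
    using integral_suminf[OF int s1 s2] by (simp add: set_lebesgue_integral_def eq) (simp add: F_def)
qed

lemma norm_set_integral_le:
  fixes f :: "real \<Rightarrow> complex" and w :: "real \<Rightarrow> real"
  assumes "set_borel_measurable lborel A f" "set_integrable lborel A w" "\<And>t. t \<in> A \<Longrightarrow> norm (f t) \<le> w t"
  shows "set_integrable lborel A f" "norm (LINT t:A|lborel. f t) \<le> (LINT t:A|lborel. w t)"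
proof -
  have *: "norm (indicator A t *\<^sub>R f t) \<le> indicator A t *\<^sub>R w t" for t
    using assms(3)[of t] by (simp add: indicator_def)
  show i: "set_integrable lborel A f"
    unfolding set_integrable_def
  proof (rule Bochner_Integration.integrable_bound[OF assms(2)[unfolded set_integrable_def]])
    show "(\<lambda>t. indicator A t *\<^sub>R f t) \<in> borel_measurable lborel"
      using assms(1) by (simp add: set_borel_measurable_def)
    show "AE t in lborel. norm (indicator A t *\<^sub>R f t) \<le> norm (indicator A t *\<^sub>R w t)"
      by (intro AE_I2) (metis * abs_ge_self order_trans real_norm_def)
  qed
  show "norm (LINT t:A|lborel. f t) \<le> (LINT t:A|lborel. w t)"
    unfolding set_lebesgue_integral_def
    by (rule Bochner_Integration.integral_norm_bound_integral) (use i assms(2) * in \<open>auto simp: set_integrable_def\<close>)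
qed

lemma set_borel_measurable_lborel:
  fixes f :: "real \<Rightarrow> complex"
  assumes "f \<in> borel_measurable borel" "A \<in> sets borel"
  shows "set_borel_measurable lborel A f"
  using assms unfolding set_borel_measurable_def by measurable

text \<open>Here \<open>b\<close> stands for a/3, \<open>r\<close> for the radius of a smaller disc
  in \<open>l\<close>, \<open>C\<close> for the kernel constant on it and \<open>Q\<close> for a
  weighted L1 norm of the potential. The weight \<open>W\<close> serves the induction on the
  iterated kernels only; afterwards its effect is summarized by the constant
  \<open>D\<close>.\<close>

locale decaying_potential =
  fixes q :: "real \<Rightarrow> real" and b r C D Q :: real and W :: "real \<Rightarrow> real"
  assumes q_meas [measurable]: "q \<in> borel_measurable borel"
    and b_pos: "b > 0" and r_less: "r < b"
    and C_def: "C = 2 / (b - r)\<^sup>2"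
    and q_int: "integrable lborel (\<lambda>t. exp (2 * b * \<bar>t\<bar>) * \<bar>q t\<bar>)"
    and Q_def: "Q = (LINT t|lborel. exp (2 * b * \<bar>t\<bar>) * \<bar>q t\<bar>)"
    and W_meas [measurable]: "W \<in> borel_measurable borel"
    and W_ge_1: "1 \<le> W s" and W_le: "C * W s \<le> D"
    and W_int: "t \<le> x \<Longrightarrow> C * (LINT s:{t..x}|lborel. \<bar>q s\<bar> * W s) \<le> W t / 2"
begin

lemma C_pos: "C > 0"
  using r_less by (simp add: C_def)

lemma D_pos: "D > 0"
  using W_le[of 0] W_ge_1[of 0] C_pos mult_pos_pos[of C "W 0"] by linarith

lemma Q_nonneg: "Q \<ge> 0"
  unfolding Q_def by (intro integral_nonneg_AE) auto

lemma K1_bound: "norm l \<le> r \<Longrightarrow> t \<le> x \<Longrightarrow> norm (K1 l x t) \<le> C * exp (b * (x - t))"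
  using norm_K1_le_exp[OF _ r_less] by (simp add: C_def)

lemma q_integrable: "integrable lborel (\<lambda>t. \<bar>q t\<bar>)"
proof (rule Bochner_Integration.integrable_bound[OF q_int])
  show "AE t in lborel. norm \<bar>q t\<bar> \<le> norm (exp (2 * b * \<bar>t\<bar>) * \<bar>q t\<bar>)"
  proof (rule AE_I2)
    fix t
    have "1 * \<bar>q t\<bar> \<le> exp (2 * b * \<bar>t\<bar>) * \<bar>q t\<bar>"
      using b_pos by (intro mult_right_mono) auto
    thus "norm \<bar>q t\<bar> \<le> norm (exp (2 * b * \<bar>t\<bar>) * \<bar>q t\<bar>)" by simp
  qed
qed measurable

lemma set_integrable_q:
  assumes "A \<in> sets borel"
  shows "set_integrable lborel A (\<lambda>t. exp (2 * b * \<bar>t\<bar>) * \<bar>q t\<bar>)"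
    and "(LINT t:A|lborel. exp (2 * b * \<bar>t\<bar>) * \<bar>q t\<bar>) \<le> Q"
    and "set_integrable lborel A (\<lambda>t. \<bar>q t\<bar>)"
    and "set_integrable lborel A (\<lambda>t. \<bar>q t\<bar> * W t)"
proof -
  show i: "set_integrable lborel A (\<lambda>t. exp (2 * b * \<bar>t\<bar>) * \<bar>q t\<bar>)"
    unfolding set_integrable_def using assms by (intro integrable_mult_indicator q_int) auto
  show "(LINT t:A|lborel. exp (2 * b * \<bar>t\<bar>) * \<bar>q t\<bar>) \<le> Q"
    unfolding set_lebesgue_integral_def Q_def
    by (rule integral_mono) (use i q_int in \<open>auto simp: set_integrable_def indicator_def\<close>)
  show qi: "set_integrable lborel A (\<lambda>t. \<bar>q t\<bar>)"
    unfolding set_integrable_def using assms by (intro integrable_mult_indicator q_integrable) auto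
  have W0: "\<bar>W t\<bar> \<le> D / C" for t
    using W_le[of t] W_ge_1[of t] C_pos by (simp add: pos_le_divide_eq mult.commute)
  have [measurable]: "A \<in> sets borel" by (rule assms)
  show "set_integrable lborel A (\<lambda>t. \<bar>q t\<bar> * W t)"
  proof (rule set_integrable_bound)
    show "set_integrable lborel A (\<lambda>t. D / C * \<bar>q t\<bar>)"
      using qi by (rule set_integrable_mult_right)
    show "set_borel_measurable lborel A (\<lambda>t. \<bar>q t\<bar> * W t)"
      unfolding set_borel_measurable_def by measurable
    show "AE t in lborel. t \<in> A \<longrightarrow> norm (\<bar>q t\<bar> * W t) \<le> norm (D / C * \<bar>q t\<bar>)"
    proof (intro AE_I2 impI)
      fix t
      have "\<bar>W t\<bar> * \<bar>q t\<bar> \<le> D / C * \<bar>q t\<bar>" by (intro mult_right_mono W0) auto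
      thus "norm (\<bar>q t\<bar> * W t) \<le> norm (D / C * \<bar>q t\<bar>)"
        using C_pos D_pos by (simp add: abs_mult mult.commute)
    qed
  qed
qed

lemmas Khat_measurable [measurable] = borel_measurable_Khat[OF q_meas]

lemma Khat_Suc: "Khat q (Suc n) l x t = (LINT s:{t..x}|lborel. Khat q n l x s * of_real (q s) * K1 l s t)"
  by (rule Khat_Suc_lborel) measurable

declare Khat.simps(2) [simp del]

text \<open>The exponentials of the two factors multiply to exp (b (x - t)), from which
  \<open>s\<close> has disappeared; what remains under the integral is
  \<open>\<bar>q s\<bar> * W s\<close>. The weight is attached to the last argument because that is
  the one integrated in the next step: \<open>W s\<close> is exchanged for
  \<open>W t / 2\<close>.\<close>

lemma Khat_bound_W:
  assumes "norm l \<le> r" "t \<le> x"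
  shows "norm (Khat q n l x t) \<le> C * exp (b * (x - t)) * (1 / 2) ^ n * W t"
  using assms(2)
proof (induction n arbitrary: t)
  case 0
  have "norm (K1 l x t) * 1 \<le> C * exp (b * (x - t)) * W t"
    using K1_bound[OF assms(1) 0] W_ge_1[of t] C_pos by (intro mult_mono) auto
  thus ?case by simp
next
  case (Suc n)
  define E where "E = C * C * exp (b * (x - t)) * (1 / 2) ^ n"
  have bd: "norm (Khat q n l x s * of_real (q s) * K1 l s t) \<le> E * (\<bar>q s\<bar> * W s)" if s: "s \<in> {t..x}" for s
  proof -
    have "norm (Khat q n l x s) * \<bar>q s\<bar> * norm (K1 l s t) \<le>
        (C * exp (b * (x - s)) * (1 / 2) ^ n * W s) * \<bar>q s\<bar> * (C * exp (b * (s - t)))"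
      using s C_pos W_ge_1[of s]
      by (intro mult_mono Suc.IH K1_bound[OF assms(1)]) auto
    also have "\<dots> = C * C * (exp (b * (x - s)) * exp (b * (s - t))) * (1 / 2) ^ n * (\<bar>q s\<bar> * W s)"
      by (simp only: mult_ac)
    also have "exp (b * (x - s)) * exp (b * (s - t)) = exp (b * (x - t))"
      by (simp add: algebra_simps flip: exp_add)
    finally show ?thesis unfolding E_def by (simp add: norm_mult)
  qed
  have "norm (Khat q (Suc n) l x t) \<le> (LINT s:{t..x}|lborel. E * (\<bar>q s\<bar> * W s))"
    unfolding Khat_Suc
    by (rule norm_set_integral_le(2)[OF _ _ bd])
       (auto intro!: set_borel_measurable_lborel set_integrable_q)
  also have "\<dots> = C * exp (b * (x - t)) * (1 / 2) ^ n * (C * (LINT s:{t..x}|lborel. \<bar>q s\<bar> * W s))"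
    by (simp add: E_def)
  also have "\<dots> \<le> C * exp (b * (x - t)) * (1 / 2) ^ n * (W t / 2)"
    using C_pos W_int[OF Suc.prems] by (intro mult_left_mono) auto
  finally show ?case by simp
qed

lemma Khat_bound:
  assumes "norm l \<le> r" "t \<le> x"
  shows "norm (Khat q n l x t) \<le> D * exp (b * (x - t)) * (1 / 2) ^ n"
proof -
  have "norm (Khat q n l x t) \<le> (C * W t) * (exp (b * (x - t)) * (1 / 2) ^ n)"
    using Khat_bound_W[OF assms, of n] by (simp add: mult_ac)
  also have "\<dots> \<le> D * (exp (b * (x - t)) * (1 / 2) ^ n)"
    by (intro mult_right_mono W_le) auto
  finally show ?thesis by (simp add: mult.assoc)
qed

lemma Khat_integrand_bound:
  assumes "norm l \<le> r" "t \<le> s" "s \<le> x"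
  shows "norm (Khat q n l x s * of_real (q s) * K1 l s t) \<le> D * C * exp (b * (x - t)) * (1 / 2) ^ n * \<bar>q s\<bar>"
proof -
  have "norm (Khat q n l x s) * \<bar>q s\<bar> * norm (K1 l s t) \<le>
      (D * exp (b * (x - s)) * (1 / 2) ^ n) * \<bar>q s\<bar> * (C * exp (b * (s - t)))"
    using assms C_pos D_pos by (intro mult_mono Khat_bound K1_bound) auto
  also have "\<dots> = D * C * (exp (b * (x - s)) * exp (b * (s - t))) * (1 / 2) ^ n * \<bar>q s\<bar>"
    by (simp only: mult_ac)
  also have "exp (b * (x - s)) * exp (b * (s - t)) = exp (b * (x - t))"
    by (simp add: algebra_simps flip: exp_add)
  finally show ?thesis by (simp add: norm_mult)
qed

lemma Khat_integrand_integrable: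
  assumes "norm l \<le> r"
  shows "set_integrable lborel {t..x} (\<lambda>s. Khat q n l x s * of_real (q s) * K1 l s t)"
proof (rule norm_set_integral_le(1))
  show "set_integrable lborel {t..x} (\<lambda>s. D * C * exp (b * (x - t)) * (1 / 2) ^ n * \<bar>q s\<bar>)"
    by (intro set_integrable_mult_right set_integrable_q) auto
qed (auto intro!: set_borel_measurable_lborel Khat_integrand_bound assms)

text \<open>\<open>t\<close> is kept free in the induction because the integrand contains the
  previous kernel at every \<open>s\<close> in \<open>{t..x}\<close>. The majorant is a multiple of
  \<open>\<bar>q s\<bar>\<close> independent of \<open>l\<close>.\<close>

lemma Khat_holomorphic:
  assumes "t \<le> x"
  shows "(\<lambda>l. Khat q n l x t) holomorphic_on ball 0 r"
  using assms
proof (induction n arbitrary: t)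
  case 0
  show ?case by (simp add: holomorphic_on_K1)
next
  case (Suc n)
  let ?F = "\<lambda>l s. indicator {t..x} s *\<^sub>R (Khat q n l x s * of_real (q s) * K1 l s t)"
  have "(\<lambda>l. LINT s|lborel. ?F l s) holomorphic_on ball 0 r"
  proof (rule holomorphic_on_integral)
    show "(\<lambda>l. ?F l s) holomorphic_on ball 0 r" for s
    proof (cases "s \<in> {t..x}")
      case True
      thus ?thesis using Suc.IH[of s] by (auto intro!: holomorphic_intros holomorphic_on_K1)
    qed simp
    show "integrable lborel (\<lambda>s. D * C * exp (b * (x - t)) * (1 / 2) ^ n * \<bar>q s\<bar>)"
      using q_integrable by simp
    show "norm (?F l s) \<le> D * C * exp (b * (x - t)) * (1 / 2) ^ n * \<bar>q s\<bar>" if "l \<in> ball 0 r" for l s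
    proof (cases "s \<in> {t..x}")
      case True
      thus ?thesis using Khat_integrand_bound[of l t s x n] that by simp
    next
      case False
      thus ?thesis using C_pos D_pos by simp
    qed
  qed auto
  thus ?case by (simp add: Khat_Suc set_lebesgue_integral_def)
qed

end

section \<open>Powers of the Volterra operator on exponentially bounded functions\<close>

context decaying_potential
begin

text \<open>As for \<open>Khat\<close>, the index is shifted: \<open>T n l\<close> is the power \<open>n + 1\<close> of the Volterra operator.\<close>

definition T :: "nat \<Rightarrow> complex \<Rightarrow> (real \<Rightarrow> complex) \<Rightarrow> real \<Rightarrow> complex" where
  "T n l f x = (LINT t:{..x}|lborel. Khat q n l x t * (of_real (q t) * f t))"

text \<open>Growth is allowed at both ends, as for plane waves with complex frequency. The constant
  \<open>M\<close> is carried along so that sums of powers can be estimated.\<close>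

definition exp_bounded :: "real \<Rightarrow> (real \<Rightarrow> complex) \<Rightarrow> bool" where
  "exp_bounded M f \<longleftrightarrow> f \<in> borel_measurable borel \<and> (\<forall>t. norm (f t) \<le> M * exp (b * \<bar>t\<bar>))"

lemma exp_bounded_measurable: "exp_bounded M f \<Longrightarrow> f \<in> borel_measurable borel"
  and exp_boundedD: "exp_bounded M f \<Longrightarrow> norm (f t) \<le> M * exp (b * \<bar>t\<bar>)"
  by (simp_all add: exp_bounded_def)

lemma exp_bounded_nonneg: "exp_bounded M f \<Longrightarrow> M \<ge> 0"
  using exp_boundedD[of M f 0] norm_ge_zero[of "f 0"] by (simp add: order_trans[OF norm_ge_zero])

text \<open>The origin of exp (2 b |t|): one factor exp (b |t|) bounds exp (- b t) from the kernel,
  the other bounds the growth of \<open>f\<close>.\<close>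

lemma exp_weight_bound:
  assumes f: "exp_bounded M f" and "t \<le> x" and "k \<ge> 0"
  shows "k * exp (b * (x - t)) * (\<bar>q t\<bar> * norm (f t)) \<le> k * M * exp (b * x) * (exp (2 * b * \<bar>t\<bar>) * \<bar>q t\<bar>)"
proof -
  have "k * exp (b * (x - t)) * (\<bar>q t\<bar> * norm (f t)) \<le> k * exp (b * x + b * \<bar>t\<bar>) * (\<bar>q t\<bar> * (M * exp (b * \<bar>t\<bar>)))"
  proof (intro mult_mono exp_boundedD[OF f] order.refl)
    have "b * (x - t) \<le> b * (x + \<bar>t\<bar>)" using b_pos by (intro mult_left_mono) auto
    thus "exp (b * (x - t)) \<le> exp (b * x + b * \<bar>t\<bar>)" by (simp add: algebra_simps)
  qed (use assms(3) exp_bounded_nonneg[OF f] in auto)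
  also have "\<dots> = k * M * exp (b * x) * (exp (b * \<bar>t\<bar>) * exp (b * \<bar>t\<bar>) * \<bar>q t\<bar>)"
    by (simp add: exp_add mult_ac)
  also have "exp (b * \<bar>t\<bar>) * exp (b * \<bar>t\<bar>) = exp (2 * b * \<bar>t\<bar>)"
    by (simp flip: exp_add)
  finally show ?thesis .
qed

lemma T_integrand_bound:
  assumes l: "norm l \<le> r" and f: "exp_bounded M f" and "t \<le> x"
  shows "norm (Khat q n l x t * (of_real (q t) * f t)) \<le> (1 / 2) ^ n * (D * M * exp (b * x) * (exp (2 * b * \<bar>t\<bar>) * \<bar>q t\<bar>))"
proof -
  have "norm (Khat q n l x t * (of_real (q t) * f t)) \<le> D * exp (b * (x - t)) * (1 / 2) ^ n * (\<bar>q t\<bar> * norm (f t))"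
    unfolding norm_mult norm_of_real by (intro mult_right_mono Khat_bound l assms(3)) auto
  also have "\<dots> = (1 / 2) ^ n * (D * exp (b * (x - t)) * (\<bar>q t\<bar> * norm (f t)))"
    by (simp only: mult_ac)
  also have "\<dots> \<le> (1 / 2) ^ n * (D * M * exp (b * x) * (exp (2 * b * \<bar>t\<bar>) * \<bar>q t\<bar>))"
    using D_pos by (intro mult_left_mono exp_weight_bound f assms(3)) auto
  finally show ?thesis .
qed

lemma T_integrand_measurable:
  assumes "exp_bounded M f"
  shows "set_borel_measurable lborel {..x} (\<lambda>t. Khat q n l x t * (of_real (q t) * f t))"
proof -
  have [measurable]: "f \<in> borel_measurable borel" by (rule exp_bounded_measurable[OF assms])
  show ?thesis by (rule set_borel_measurable_lborel) measurable
qed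

lemma T_integrable:
  assumes "norm l \<le> r" and "exp_bounded M f"
  shows "set_integrable lborel {..x} (\<lambda>t. Khat q n l x t * (of_real (q t) * f t))"
  by (rule norm_set_integral_le(1)[OF T_integrand_measurable[OF assms(2)] _ T_integrand_bound[OF assms]])
     (auto intro!: set_integrable_mult_right set_integrable_q)

text \<open>The bound has exp (b x), not exp (b |x|). Thus the image decays at -infinity even if
  \<open>f\<close> grows there, and this is the source of the Jost asymptotics.\<close>

lemma norm_T_le:
  assumes "norm l \<le> r" and "exp_bounded M f"
  shows "norm (T n l f x) \<le> (1 / 2) ^ n * (D * M * Q) * exp (b * x)"
proof -
  have "norm (T n l f x) \<le> (LINT t:{..x}|lborel. (1 / 2) ^ n * (D * M * exp (b * x) * (exp (2 * b * \<bar>t\<bar>) * \<bar>q t\<bar>)))"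
    unfolding T_def
    by (rule norm_set_integral_le(2)[OF T_integrand_measurable[OF assms(2)] _ T_integrand_bound[OF assms]])
       (auto intro!: set_integrable_mult_right set_integrable_q)
  also have "\<dots> = (1 / 2) ^ n * (D * M * exp (b * x) * (LINT t:{..x}|lborel. exp (2 * b * \<bar>t\<bar>) * \<bar>q t\<bar>))"
    by (simp only: set_integral_mult_right)
  also have "\<dots> \<le> (1 / 2) ^ n * (D * M * exp (b * x) * Q)"
    using D_pos exp_bounded_nonneg[OF assms(2)]
    by (intro mult_left_mono set_integrable_q(2)) auto
  finally show ?thesis by (simp add: mult_ac)
qed

text \<open>Measurability of the image in \<open>x\<close> rests on joint measurability of the
  kernel in \<open>(x, t)\<close>, which is at hand for \<open>K1\<close>, while for the iterated
  kernels only the last argument has been treated. Higher powers are therefore reached by composing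
  with \<open>T 0\<close>.\<close>

lemma exp_bounded_T_0:
  assumes "norm l \<le> r" and f: "exp_bounded M f"
  shows "exp_bounded (D * M * Q) (T 0 l f)"
  unfolding exp_bounded_def
proof (intro conjI allI)
  have [measurable]: "f \<in> borel_measurable borel" by (rule exp_bounded_measurable[OF f])
  have "(\<lambda>p. if snd p \<le> fst p then K1 l (fst p) (snd p) * (of_real (q (snd p)) * f (snd p)) else 0) \<in> borel_measurable (borel \<Otimes>\<^sub>M lborel)"
    by measurable
  also have "(\<lambda>p. if snd p \<le> fst p then K1 l (fst p) (snd p) * (of_real (q (snd p)) * f (snd p)) else 0)
      = (\<lambda>(x, t). indicator {..x} t *\<^sub>R (K1 l x t * (of_real (q t) * f t)))"
    by (auto simp: fun_eq_iff indicator_def)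
  finally have "(\<lambda>x. LINT t|lborel. indicator {..x} t *\<^sub>R (K1 l x t * (of_real (q t) * f t))) \<in> borel_measurable borel"
    by (rule lborel.borel_measurable_lebesgue_integral)
  thus "T 0 l f \<in> borel_measurable borel"
    by (simp add: T_def[abs_def] set_lebesgue_integral_def)
  fix x
  have "norm (T 0 l f x) \<le> (D * M * Q) * exp (b * x)"
    using norm_T_le[OF assms, of 0 x] by simp
  also have "\<dots> \<le> (D * M * Q) * exp (b * \<bar>x\<bar>)"
    using b_pos D_pos exp_bounded_nonneg[OF f] Q_nonneg
    by (intro mult_left_mono) auto
  finally show "norm (T 0 l f x) \<le> (D * M * Q) * exp (b * \<bar>x\<bar>)" .
qed

text \<open>The recursion for \<open>Khat\<close> adds a factor \<open>K1\<close> on the right, next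
  to \<open>f\<close>; Fubini over the triangle lets this factor act on \<open>f\<close>
  first.\<close>

lemma T_Suc:
  assumes l: "norm l \<le> r" and f: "exp_bounded M f"
  shows "T (Suc n) l f x = T n l (T 0 l f) x"
proof -
  have [measurable]: "f \<in> borel_measurable borel" by (rule exp_bounded_measurable[OF f])
  define G where "G s t = Khat q n l x s * of_real (q s) * K1 l s t * (of_real (q t) * f t)" for s t
  have Gm: "(\<lambda>(s, t). G s t) \<in> borel_measurable (lborel \<Otimes>\<^sub>M lborel)"
    unfolding G_def by measurable
  let ?k = "D * C * (1 / 2) ^ n"
  have bd: "norm (G s t) \<le> (?k * M * exp (b * x) * \<bar>q s\<bar>) * (exp (2 * b * \<bar>t\<bar>) * \<bar>q t\<bar>)" if "t \<le> s" "s \<le> x" for s t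
  proof -
    have "norm (G s t) \<le> D * C * exp (b * (x - t)) * (1 / 2) ^ n * \<bar>q s\<bar> * norm (of_real (q t) * f t)"
      unfolding G_def norm_mult[of "Khat q n l x s * of_real (q s) * K1 l s t"]
      using Khat_integrand_bound[OF l that] by (intro mult_right_mono) auto
    also have "\<dots> = \<bar>q s\<bar> * (?k * exp (b * (x - t)) * (\<bar>q t\<bar> * norm (f t)))"
      by (simp add: norm_mult mult_ac)
    also have "\<dots> \<le> \<bar>q s\<bar> * (?k * M * exp (b * x) * (exp (2 * b * \<bar>t\<bar>) * \<bar>q t\<bar>))"
      using that C_pos D_pos by (intro mult_left_mono exp_weight_bound[OF f]) auto
    finally show ?thesis by (simp only: mult_ac)
  qed
  have "T (Suc n) l f x = (LINT t:{..x}|lborel. LINT s:{t..x}|lborel. G s t)"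
    by (simp add: T_def Khat_Suc G_def)
  also have "\<dots> = (LINT s:{..x}|lborel. LINT t:{..s}|lborel. G s t)"
    by (rule Fubini_triangle(1)[OF Gm _ _ bd])
       (auto intro!: set_integrable_mult_right set_integrable_q)
  also have "\<dots> = T n l (T 0 l f) x"
    by (simp add: T_def G_def mult.assoc)
  finally show ?thesis .
qed

text \<open>The Volterra equation and measurability both want the new factor on the left. Powers of
  one operator commute; the induction varies \<open>f\<close>, since \<open>T 0 l f\<close> takes
  its place.\<close>

lemma T_Suc':
  assumes l: "norm l \<le> r" and f: "exp_bounded M f"
  shows "T (Suc n) l f = T 0 l (T n l f)"
  using f
proof (induction n arbitrary: f M)
  case 0
  show ?case using T_Suc[OF l 0] by (simp add: fun_eq_iff)
next
  case (Suc n)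
  have "T (Suc (Suc n)) l f = T (Suc n) l (T 0 l f)"
    using T_Suc[OF l Suc.prems] by (simp add: fun_eq_iff)
  also have "\<dots> = T 0 l (T n l (T 0 l f))"
    by (rule Suc.IH[OF exp_bounded_T_0[OF l Suc.prems]])
  also have "T n l (T 0 l f) = T (Suc n) l f"
    using T_Suc[OF l Suc.prems] by (simp add: fun_eq_iff)
  finally show ?case .
qed

lemma exp_bounded_T:
  assumes "norm l \<le> r" and f: "exp_bounded M f"
  shows "exp_bounded ((1 / 2) ^ n * (D * M * Q)) (T n l f)"
  unfolding exp_bounded_def
proof (intro conjI allI)
  show "T n l f \<in> borel_measurable borel"
  proof (induction n)
    case 0
    show ?case by (rule exp_bounded_measurable[OF exp_bounded_T_0[OF assms]])
  next
    case (Suc n)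
    have "norm (T n l f x) \<le> (D * M * Q) * exp (b * \<bar>x\<bar>)" for x
    proof -
      have "norm (T n l f x) \<le> (1 / 2) ^ n * (D * M * Q) * exp (b * x)" by (rule norm_T_le[OF assms])
      also have "\<dots> \<le> 1 * (D * M * Q) * exp (b * \<bar>x\<bar>)"
        using b_pos D_pos exp_bounded_nonneg[OF f] Q_nonneg
        by (intro mult_mono) (auto simp: power_le_one)
      finally show ?thesis by simp
    qed
    hence "exp_bounded (D * M * Q) (T n l f)" using Suc by (simp add: exp_bounded_def)
    thus ?case
      unfolding T_Suc'[OF assms] by (rule exp_bounded_measurable[OF exp_bounded_T_0[OF assms(1)]])
  qed
  fix x
  have "norm (T n l f x) \<le> (1 / 2) ^ n * (D * M * Q) * exp (b * x)" by (rule norm_T_le[OF assms])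
  also have "\<dots> \<le> (1 / 2) ^ n * (D * M * Q) * exp (b * \<bar>x\<bar>)"
    using b_pos D_pos exp_bounded_nonneg[OF f] Q_nonneg
    by (intro mult_left_mono) auto
  finally show "norm (T n l f x) \<le> (1 / 2) ^ n * (D * M * Q) * exp (b * \<bar>x\<bar>)" .
qed

lemma summable_half_power_mult: "summable (\<lambda>n. (1 / 2 :: real) ^ n * c)"
  by (intro summable_mult2 summable_geometric) simp

lemma suminf_half_power_mult: "(\<Sum>n. (1 / 2 :: real) ^ n * c) = 2 * c"
  using suminf_mult2[OF summable_geometric[of "1 / 2 :: real"], of c] suminf_geometric[of "1 / 2 :: real"] by simp

lemma exp_bounded_suminf:
  assumes "\<And>n. exp_bounded ((1 / 2) ^ n * M) (f n)"
  shows "summable (\<lambda>n. f n x)" and "exp_bounded (2 * M) (\<lambda>x. \<Sum>n. f n x)"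
proof -
  have bd: "norm (f n t) \<le> (1 / 2) ^ n * (M * exp (b * \<bar>t\<bar>))" for n t
    using exp_boundedD[OF assms] by (simp add: mult.assoc)
  show "summable (\<lambda>n. f n x)"
    by (rule summable_comparison_test'[OF summable_half_power_mult bd])
  have "norm (\<Sum>n. f n t) \<le> 2 * M * exp (b * \<bar>t\<bar>)" for t
  proof -
    have "norm (\<Sum>n. f n t) \<le> (\<Sum>n. (1 / 2) ^ n * (M * exp (b * \<bar>t\<bar>)))"
      by (rule norm_suminf_le[OF bd summable_half_power_mult])
    thus ?thesis unfolding suminf_half_power_mult by simp
  qed
  moreover have "(\<lambda>x. \<Sum>n. f n x) \<in> borel_measurable borel"
    by (intro borel_measurable_suminf exp_bounded_measurable[OF assms])
  ultimately show "exp_bounded (2 * M) (\<lambda>x. \<Sum>n. f n x)"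
    by (simp add: exp_bounded_def)
qed

lemma T_0_suminf:
  assumes l: "norm l \<le> r" and f: "\<And>n. exp_bounded ((1 / 2) ^ n * M) (f n)"
  shows "T 0 l (\<lambda>t. \<Sum>n. f n t) x = (\<Sum>n. T 0 l (f n) x)"
proof -
  have "T 0 l (\<lambda>t. \<Sum>n. f n t) x = (LINT t:{..x}|lborel. \<Sum>n. Khat q 0 l x t * (of_real (q t) * f n t))"
    unfolding T_def
    by (simp add: suminf_mult exp_bounded_suminf(1)[OF f] summable_mult)
  also have "\<dots> = (\<Sum>n. T 0 l (f n) x)"
    unfolding T_def
  proof (rule set_integral_suminf(2))
    show "set_borel_measurable lborel {..x} (\<lambda>t. Khat q 0 l x t * (of_real (q t) * f n t))" for n
      by (rule T_integrand_measurable[OF f])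
    show "set_integrable lborel {..x} (\<lambda>t. D * M * exp (b * x) * (exp (2 * b * \<bar>t\<bar>) * \<bar>q t\<bar>))"
      by (intro set_integrable_mult_right set_integrable_q) auto
    show "norm (Khat q 0 l x t * (of_real (q t) * f n t)) \<le> (1 / 2) ^ n * (D * M * exp (b * x) * (exp (2 * b * \<bar>t\<bar>) * \<bar>q t\<bar>))"
      if "t \<in> {..x}" for n t
      using T_integrand_bound[OF l f[of n], of t x 0] that by (simp add: mult_ac)
  qed
  finally show ?thesis .
qed

end

section \<open>Jost solutions as Neumann series\<close>

context decaying_potential
begin

text \<open>The integral formula with sum and integral exchanged, as justified in
  \<open>Nhat_integral\<close>. In this form the Volterra equation and uniform convergence in
  \<open>l\<close> are checked term by term.\<close>

definition jost :: "nat \<Rightarrow> complex \<Rightarrow> real \<Rightarrow> complex" where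
  "jost k l x = exp (\<i> * l * zeta k * of_real x) +
     (\<Sum>n. \<i> ^ Suc n * T n l (\<lambda>t. exp (\<i> * l * zeta k * of_real t)) x)"

lemma exp_bounded_plane_wave:
  assumes "norm l \<le> r"
  shows "exp_bounded 1 (\<lambda>t. exp (\<i> * l * zeta k * of_real t))"
  unfolding exp_bounded_def
proof (intro conjI allI)
  show "(\<lambda>t. exp (\<i> * l * zeta k * complex_of_real t)) \<in> borel_measurable borel"
    by (intro borel_measurable_continuous_onI continuous_intros)
  fix t :: real
  have "norm (exp (\<i> * l * zeta k * of_real t)) \<le> exp (norm (\<i> * l * zeta k * of_real t))"
    by (rule norm_exp)
  also have "norm (\<i> * l * zeta k * of_real t) = norm l * \<bar>t\<bar>"
    by (simp add: norm_mult norm_zeta)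
  also have "exp (norm l * \<bar>t\<bar>) \<le> 1 * exp (b * \<bar>t\<bar>)"
    using assms r_less by (simp add: mult_right_mono)
  finally show "norm (exp (\<i> * l * zeta k * of_real t)) \<le> 1 * exp (b * \<bar>t\<bar>)"
    by simp
qed

lemma Nhat_summable:
  assumes "norm l \<le> r" "t \<le> x"
  shows "summable (\<lambda>n. \<i> ^ Suc n * Khat q n l x t)"
proof (rule summable_comparison_test'[OF summable_half_power_mult])
  show "norm (\<i> ^ Suc n * Khat q n l x t) \<le> (1 / 2) ^ n * (D * exp (b * (x - t)))" for n
    using Khat_bound[OF assms, of n] by (simp add: norm_mult norm_power mult_ac)
qed

lemma Nhat_measurable: "(\<lambda>t. Nhat q l x t) \<in> borel_measurable borel"
  unfolding Nhat_def by (intro borel_measurable_suminf) measurable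

lemma Nhat_integral:
  assumes l: "norm l \<le> r" and f: "exp_bounded M f"
  shows "set_integrable lborel {..x} (\<lambda>t. Nhat q l x t * (of_real (q t) * f t))"
    and "(LINT t:{..x}|lborel. Nhat q l x t * (of_real (q t) * f t)) = (\<Sum>n. \<i> ^ Suc n * T n l f x)"
proof -
  let ?F = "\<lambda>n t. \<i> ^ Suc n * (Khat q n l x t * (of_real (q t) * f t))"
  let ?w = "\<lambda>t. D * M * exp (b * x) * (exp (2 * b * \<bar>t\<bar>) * \<bar>q t\<bar>)"
  have [measurable]: "f \<in> borel_measurable borel" by (rule exp_bounded_measurable[OF f])
  have m: "set_borel_measurable lborel {..x} (?F n)" for n
    by (rule set_borel_measurable_lborel) measurable
  have w: "set_integrable lborel {..x} ?w"
    by (intro set_integrable_mult_right set_integrable_q) auto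
  have bd: "norm (?F n t) \<le> (1 / 2) ^ n * ?w t" if "t \<in> {..x}" for n t
    using T_integrand_bound[OF l f, of t x n] that
    unfolding norm_mult[of "\<i> ^ Suc n"] norm_power by simp
  have eq: "(\<Sum>n. ?F n t) = Nhat q l x t * (of_real (q t) * f t)" if "t \<in> {..x}" for t
    using suminf_mult2[OF Nhat_summable[OF l], of t x "of_real (q t) * f t"] that
    by (simp add: Nhat_def mult.assoc)
  show "set_integrable lborel {..x} (\<lambda>t. Nhat q l x t * (of_real (q t) * f t))"
    using set_integral_suminf(1)[OF m w bd] by (subst set_integrable_cong[OF refl refl eq[symmetric]])
  have "(LINT t:{..x}|lborel. Nhat q l x t * (of_real (q t) * f t)) = (LINT t:{..x}|lborel. \<Sum>n. ?F n t)"
    by (rule set_lebesgue_integral_cong) (use eq in auto)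
  also have "\<dots> = (\<Sum>n. LINT t:{..x}|lborel. ?F n t)"
    by (rule set_integral_suminf(2)[OF m w bd])
  finally show "(LINT t:{..x}|lborel. Nhat q l x t * (of_real (q t) * f t)) = (\<Sum>n. \<i> ^ Suc n * T n l f x)"
    by (simp add: T_def)
qed

lemma exp_bounded_mult: "exp_bounded M f \<Longrightarrow> norm c \<le> 1 \<Longrightarrow> exp_bounded M (\<lambda>x. c * f x)"
  unfolding exp_bounded_def
  by (auto simp: norm_mult intro: order_trans[OF mult_left_le_one_le])

lemma T_mult: "T n l (\<lambda>x. c * f x) x = c * T n l f x"
  unfolding T_def by (simp add: mult.left_commute[of _ c] flip: set_integral_mult_right)

lemma exp_bounded_jost_series:
  assumes l: "norm l \<le> r" and f: "exp_bounded M f"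
  shows "exp_bounded ((1 / 2) ^ n * (D * M * Q)) (\<lambda>x. \<i> ^ Suc n * T n l f x)"
  by (rule exp_bounded_mult[OF exp_bounded_T[OF l f]]) (simp add: norm_mult norm_power)

text \<open>Applying \<open>\<i> * T 0\<close> to the series raises every index by one, so it
  reproduces the series without its leading term; that term is \<open>\<i> * T 0\<close> applied to
  the plane wave.\<close>

lemma jost_Volterra:
  assumes l: "norm l \<le> r"
  shows "jost k l x = exp (\<i> * l * zeta k * of_real x) + \<i> * T 0 l (jost k l) x"
    and "exp_bounded (1 + 2 * (D * Q)) (jost k l)"
proof -
  define f where "f t = exp (\<i> * l * zeta k * of_real t)" for t
  define S where "S x = (\<Sum>n. \<i> ^ Suc n * T n l f x)" for x
  have f: "exp_bounded 1 f" unfolding f_def by (rule exp_bounded_plane_wave[OF l])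
  have fm: "f \<in> borel_measurable borel" by (rule exp_bounded_measurable[OF f])
  have bd: "exp_bounded ((1 / 2) ^ n * (D * Q)) (\<lambda>x. \<i> ^ Suc n * T n l f x)" for n
    using exp_bounded_jost_series[OF l f] by simp
  have S: "exp_bounded (2 * (D * Q)) S"
    unfolding S_def by (rule exp_bounded_suminf(2)[OF bd])
  have j: "jost k l = (\<lambda>x. f x + S x)"
    by (simp add: fun_eq_iff jost_def S_def f_def[abs_def])
  show "exp_bounded (1 + 2 * (D * Q)) (jost k l)"
    unfolding j exp_bounded_def
  proof (intro conjI allI)
    show "(\<lambda>x. f x + S x) \<in> borel_measurable borel"
      by (intro borel_measurable_add fm exp_bounded_measurable[OF S])
    fix t
    have "norm (f t + S t) \<le> norm (f t) + norm (S t)" by (rule norm_triangle_ineq)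
    also have "\<dots> \<le> 1 * exp (b * \<bar>t\<bar>) + 2 * (D * Q) * exp (b * \<bar>t\<bar>)"
      by (intro add_mono exp_boundedD f S)
    finally show "norm (f t + S t) \<le> (1 + 2 * (D * Q)) * exp (b * \<bar>t\<bar>)"
      by (simp add: distrib_right)
  qed
  have T0: "T 0 l (\<lambda>x. f x + S x) x = T 0 l f x + T 0 l S x"
    using set_integral_add(2)[OF T_integrable[OF l f, of x 0] T_integrable[OF l S, of x 0]]
    by (simp add: T_def distrib_left)
  have "T 0 l S x = (\<Sum>n. T 0 l (\<lambda>x. \<i> ^ Suc n * T n l f x) x)"
    unfolding S_def by (rule T_0_suminf[OF l bd])
  also have "\<dots> = (\<Sum>n. \<i> ^ Suc n * T (Suc n) l f x)"
    by (simp only: T_mult T_Suc'[OF l f])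
  finally have TS: "T 0 l S x = (\<Sum>n. \<i> ^ Suc n * T (Suc n) l f x)" .
  have sm: "summable (\<lambda>n. \<i> ^ Suc n * T n l f x)"
    by (rule exp_bounded_suminf(1)[OF bd])
  hence "summable (\<lambda>n. \<i> ^ Suc (Suc n) * T (Suc n) l f x)"
    by (rule iffD2[OF summable_Suc_iff])
  hence "summable (\<lambda>n. \<i> * (\<i> ^ Suc n * T (Suc n) l f x))"
    by (simp add: mult.assoc)
  hence sm': "summable (\<lambda>n. \<i> ^ Suc n * T (Suc n) l f x)"
    by (rule summable_mult_D) simp
  have "S x = (\<Sum>n. \<i> ^ Suc (Suc n) * T (Suc n) l f x) + \<i> ^ Suc 0 * T 0 l f x"
    unfolding S_def using suminf_split_head[OF sm] by simp
  also have "(\<Sum>n. \<i> ^ Suc (Suc n) * T (Suc n) l f x) = (\<Sum>n. \<i> * (\<i> ^ Suc n * T (Suc n) l f x))"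
    by (simp add: mult.assoc)
  also have "\<dots> = \<i> * T 0 l S x"
    unfolding TS by (rule suminf_mult[OF sm'])
  finally have "S x = \<i> * (T 0 l f x + T 0 l S x)" by (simp add: distrib_left)
  thus "jost k l x = exp (\<i> * l * zeta k * of_real x) + \<i> * T 0 l (jost k l) x"
    unfolding j T0 by (simp only: f_def)
qed

lemma jost_solves_ode:
  assumes l: "norm l \<le> r"
  shows "solves_ode q l (jost k l)"
proof (rule solves_ode_if_Volterra[where b = b and \<omega> = "zeta k"])
  note J = jost_Volterra[OF l, of k]
  have m [measurable]: "jost k l \<in> borel_measurable borel" by (rule exp_bounded_measurable[OF J(2)])
  show "norm l < b" using l r_less by simp
  show "zeta k ^ 3 = 1" by (rule zeta_cube)
  show "(\<lambda>t. of_real (q t) * jost k l t) \<in> borel_measurable lborel" by measurable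
  show "jost k l x = exp (\<i> * l * zeta k * of_real x) + \<i> * (LINT t:{..x}|lborel. K1 l x t * (of_real (q t) * jost k l t))" for x
    using J(1)[of x] by (simp add: T_def)
  fix x
  let ?M = "1 + 2 * (D * Q)"
  show "set_integrable lborel {..x} (\<lambda>t. exp (- b * t) * norm (of_real (q t) * jost k l t))"
  proof (rule set_integrable_bound)
    show "set_integrable lborel {..x} (\<lambda>t. ?M * (exp (2 * b * \<bar>t\<bar>) * \<bar>q t\<bar>))"
      by (intro set_integrable_mult_right set_integrable_q) auto
    show "set_borel_measurable lborel {..x} (\<lambda>t. exp (- b * t) * norm (of_real (q t) * jost k l t))"
      unfolding set_borel_measurable_def by measurable
    show "AE t in lborel. t \<in> {..x} \<longrightarrow> norm (exp (- b * t) * norm (of_real (q t) * jost k l t)) \<le> norm (?M * (exp (2 * b * \<bar>t\<bar>) * \<bar>q t\<bar>))"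
    proof (intro AE_I2 impI)
      fix t
      \<comment> \<open>As before, one exponential comes from the weight exp (- b t) and one from
        the growth of the solution.\<close>
      have "exp (- b * t) * (\<bar>q t\<bar> * norm (jost k l t)) \<le> exp (b * \<bar>t\<bar>) * (\<bar>q t\<bar> * (?M * exp (b * \<bar>t\<bar>)))"
      proof (intro mult_mono exp_boundedD[OF J(2)] order.refl)
        have "b * - t \<le> b * \<bar>t\<bar>" using b_pos by (intro mult_left_mono) auto
        thus "exp (- b * t) \<le> exp (b * \<bar>t\<bar>)" by simp
      qed auto
      also have "\<dots> = ?M * (exp (b * \<bar>t\<bar>) * exp (b * \<bar>t\<bar>) * \<bar>q t\<bar>)" by (simp only: mult_ac)
      also have "exp (b * \<bar>t\<bar>) * exp (b * \<bar>t\<bar>) = exp (2 * b * \<bar>t\<bar>)" by (simp flip: exp_add)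
      finally show "norm (exp (- b * t) * norm (of_real (q t) * jost k l t)) \<le> norm (?M * (exp (2 * b * \<bar>t\<bar>) * \<bar>q t\<bar>))"
        using D_pos Q_nonneg by (simp add: norm_mult)
    qed
  qed
qed

lemma jost_series_bound:
  assumes l: "norm l \<le> r"
  shows "norm (\<i> ^ Suc n * T n l (\<lambda>t. exp (\<i> * l * zeta k * of_real t)) x) \<le> (1 / 2) ^ n * (D * Q * exp (b * x))"
  using norm_T_le[OF l exp_bounded_plane_wave[OF l], of n k x] by (simp add: norm_mult norm_power mult.assoc)

lemma jost_asymptotics:
  assumes l: "norm l \<le> r"
  shows "((\<lambda>x. jost k l x - exp (\<i> * l * zeta k * of_real x)) \<longlongrightarrow> 0) at_bot"
proof (rule Lim_null_comparison)
  show "eventually (\<lambda>x. norm (jost k l x - exp (\<i> * l * zeta k * of_real x)) \<le> 2 * (D * Q * exp (b * x))) at_bot"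
  proof (intro always_eventually allI)
    fix x
    have "norm (\<Sum>n. \<i> ^ Suc n * T n l (\<lambda>t. exp (\<i> * l * zeta k * of_real t)) x) \<le> (\<Sum>n. (1 / 2) ^ n * (D * Q * exp (b * x)))"
      by (rule norm_suminf_le[OF jost_series_bound[OF l] summable_half_power_mult])
    thus "norm (jost k l x - exp (\<i> * l * zeta k * of_real x)) \<le> 2 * (D * Q * exp (b * x))"
      unfolding suminf_half_power_mult jost_def by simp
  qed
  have "((\<lambda>x. exp (b * x)) \<longlongrightarrow> 0) at_bot"
    by (rule filterlim_compose[OF exp_at_bot]) (rule filterlim_tendsto_pos_mult_at_bot[OF tendsto_const b_pos filterlim_ident])
  from tendsto_mult_right_zero[OF this, of "2 * (D * Q)"]
  show "((\<lambda>x. 2 * (D * Q * exp (b * x))) \<longlongrightarrow> 0) at_bot" by (simp add: mult.assoc)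
qed

lemma T_holomorphic: "(\<lambda>l. T n l (\<lambda>t. exp (\<i> * l * zeta k * of_real t)) x) holomorphic_on ball 0 r"
proof -
  let ?F = "\<lambda>l t. indicator {..x} t *\<^sub>R (Khat q n l x t * (of_real (q t) * exp (\<i> * l * zeta k * of_real t)))"
  let ?w = "\<lambda>t. (1 / 2) ^ n * (D * 1 * exp (b * x) * (exp (2 * b * \<bar>t\<bar>) * \<bar>q t\<bar>))"
  have "(\<lambda>l. LINT t|lborel. ?F l t) holomorphic_on ball 0 r"
  proof (rule holomorphic_on_integral)
    show "(\<lambda>l. ?F l t) holomorphic_on ball 0 r" for t
    proof (cases "t \<in> {..x}")
      case True
      thus ?thesis by (auto intro!: holomorphic_intros Khat_holomorphic)
    qed simp
    show "?F l \<in> borel_measurable lborel" if "l \<in> ball 0 r" for l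
      using T_integrand_measurable[OF exp_bounded_plane_wave] that
      by (simp add: set_borel_measurable_def)
    show "integrable lborel ?w"
      using q_int by simp
    show "norm (?F l t) \<le> ?w t" if "l \<in> ball 0 r" for l t
    proof (cases "t \<in> {..x}")
      case True
      have "norm l \<le> r" using that by simp
      from T_integrand_bound[OF this exp_bounded_plane_wave[OF this], of t x n k] True
      show ?thesis by simp
    next
      case False
      thus ?thesis using D_pos by simp
    qed
  qed simp
  thus ?thesis by (simp add: T_def set_lebesgue_integral_def)
qed

lemma jost_holomorphic: "(\<lambda>l. jost k l x) holomorphic_on ball 0 r"
proof -
  let ?f = "\<lambda>n l. \<i> ^ Suc n * T n l (\<lambda>t. exp (\<i> * l * zeta k * of_real t)) x"
  have "(\<lambda>l. \<Sum>n. ?f n l) holomorphic_on ball 0 r"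
  proof (rule holomorphic_uniform_sequence)
    show "(\<lambda>l. \<Sum>i<n. ?f i l) holomorphic_on ball 0 r" for n
      by (intro holomorphic_intros T_holomorphic)
    fix z assume "z \<in> ball (0::complex) r"
    then obtain d where d: "d > 0" "cball z d \<subseteq> ball 0 r"
      using open_contains_cball open_ball by blast
    have "uniform_limit (cball z d) (\<lambda>n l. \<Sum>i<n. ?f i l) (\<lambda>l. \<Sum>n. ?f n l) sequentially"
      by (rule Weierstrass_m_test[OF jost_series_bound summable_half_power_mult]) (use d in force)
    with d show "\<exists>d. 0 < d \<and> cball z d \<subseteq> ball 0 r \<and> uniform_limit (cball z d) (\<lambda>n l. \<Sum>i<n. ?f i l) (\<lambda>l. \<Sum>n. ?f n l) sequentially"
      by blast
  qed simp
  thus ?thesis unfolding jost_def by (intro holomorphic_intros)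
qed

end

section \<open>From the hypothesis on the potential to the theorem\<close>

lemma exists_decaying_potential:
  assumes q: "q \<in> borel_measurable borel" and b: "b > 0" and r: "r < b"
    and i: "integrable lborel (\<lambda>t. (q t)\<^sup>2 * exp (2 * (3 * b) * \<bar>t\<bar>))"
  obtains C D Q W where "decaying_potential q b r C D Q W"
proof -
  note [measurable] = q
  have i1: "integrable lborel (\<lambda>t. exp (2 * b * \<bar>t\<bar>) * \<bar>q t\<bar>)"
  proof (rule Bochner_Integration.integrable_bound)
    have e: "integrable lborel (\<lambda>t. exp (- (2 * b * \<bar>t\<bar>)))"
    proof -
      have 1: "set_integrable lborel {..0} (\<lambda>t. exp (2 * b * t))"
        by (rule set_integrable_exp_atMost) (use b in simp)
      have 2: "integrable lborel (\<lambda>t. indicator {..0} (0 + (- 1) * t) *\<^sub>R exp (2 * b * (0 + (- 1) * t)))"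
        by (rule lborel_integrable_real_affine) (use 1 in \<open>auto simp: set_integrable_def\<close>)
      show ?thesis
      proof (rule Bochner_Integration.integrable_bound[OF Bochner_Integration.integrable_add[OF 1[unfolded set_integrable_def] 2]])
        show "AE t in lborel. norm (exp (- (2 * b * \<bar>t\<bar>))) \<le> norm (indicator {..0} t *\<^sub>R exp (2 * b * t) + indicator {..0} (0 + (- 1) * t) *\<^sub>R exp (2 * b * (0 + (- 1) * t)))"
          by (auto simp: indicator_def abs_if)
      qed measurable
    qed
    show "integrable lborel (\<lambda>t. (q t)\<^sup>2 * exp (2 * (3 * b) * \<bar>t\<bar>) + exp (- (2 * b * \<bar>t\<bar>)))"
      by (rule Bochner_Integration.integrable_add[OF i e])
    show "AE t in lborel. norm (exp (2 * b * \<bar>t\<bar>) * \<bar>q t\<bar>) \<le> norm ((q t)\<^sup>2 * exp (2 * (3 * b) * \<bar>t\<bar>) + exp (- (2 * b * \<bar>t\<bar>)))"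
    proof (rule AE_I2)
      fix t
      \<comment> \<open>Cauchy-Schwarz in pointwise form: the product \<open>u * v\<close> is the
        function to be integrated, and \<open>u\<^sup>2\<close>, \<open>v\<^sup>2\<close> are both
        integrable. The exponent \<open>3 * b\<close> equals a.\<close>
      define u v where "u = \<bar>q t\<bar> * exp (3 * b * \<bar>t\<bar>)" and "v = exp (- (b * \<bar>t\<bar>))"
      have "0 \<le> (u - v)\<^sup>2" by simp
      hence "2 * (u * v) \<le> u\<^sup>2 + v\<^sup>2" by (simp add: power2_diff)
      moreover have "0 \<le> u * v" by (simp add: u_def v_def)
      ultimately have "u * v \<le> u\<^sup>2 + v\<^sup>2" by linarith
      moreover have "u * v = exp (2 * b * \<bar>t\<bar>) * \<bar>q t\<bar>"
        by (simp add: u_def v_def flip: exp_add)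
      moreover have "u\<^sup>2 = (q t)\<^sup>2 * exp (2 * (3 * b) * \<bar>t\<bar>)" "v\<^sup>2 = exp (- (2 * b * \<bar>t\<bar>))"
        by (simp_all add: u_def v_def power_mult_distrib mult.assoc flip: exp_double)
      ultimately show "norm (exp (2 * b * \<bar>t\<bar>) * \<bar>q t\<bar>) \<le> norm ((q t)\<^sup>2 * exp (2 * (3 * b) * \<bar>t\<bar>) + exp (- (2 * b * \<bar>t\<bar>)))"
        by (simp add: abs_mult)
    qed
  qed measurable
  have i2: "integrable lborel (\<lambda>t. (q t)\<^sup>2 * (1 + t\<^sup>2))"
  proof (rule Bochner_Integration.integrable_bound)
    \<comment> \<open>With y = 6 b |t| the inequality y^2 / 2 \<le> exp y reads 18 b^2 t^2 \<le> exp
      y; the summand 1 takes care of the 1 in 1 + t^2.\<close>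
    define K where "K = 1 + 1 / (18 * b\<^sup>2)"
    show "integrable lborel (\<lambda>t. K * ((q t)\<^sup>2 * exp (2 * (3 * b) * \<bar>t\<bar>)))"
      using i by simp
    show "AE t in lborel. norm ((q t)\<^sup>2 * (1 + t\<^sup>2)) \<le> norm (K * ((q t)\<^sup>2 * exp (2 * (3 * b) * \<bar>t\<bar>)))"
    proof (rule AE_I2)
      fix t
      let ?y = "2 * (3 * b) * \<bar>t\<bar>"
      have y: "0 \<le> ?y" using b by simp
      have *: "1 \<le> exp ?y" "?y\<^sup>2 / 2 \<le> exp ?y"
        using exp_lower_Taylor_quadratic[OF y] y by (simp, linarith)
      have "t\<^sup>2 = 1 / (18 * b\<^sup>2) * (?y\<^sup>2 / 2)" using b by (simp add: power_mult_distrib)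
      also have "\<dots> \<le> 1 / (18 * b\<^sup>2) * exp ?y" by (intro mult_left_mono *) simp
      finally have "1 + t\<^sup>2 \<le> K * exp ?y" using *(1) unfolding K_def distrib_right by linarith
      hence "(q t)\<^sup>2 * (1 + t\<^sup>2) \<le> (q t)\<^sup>2 * (K * exp ?y)" by (intro mult_left_mono) auto
      moreover have "K \<ge> 0" by (simp add: K_def)
      ultimately show "norm ((q t)\<^sup>2 * (1 + t\<^sup>2)) \<le> norm (K * ((q t)\<^sup>2 * exp (2 * (3 * b) * \<bar>t\<bar>)))"
        by (simp add: abs_mult mult_ac)
    qed
  qed measurable
  define C where "C = 2 / (b - r)\<^sup>2"
  have C: "C > 0" using r by (simp add: C_def)
  obtain W M where W: "W \<in> borel_measurable borel" "\<And>s. 1 \<le> W s" "\<And>s. W s \<le> M"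
    "\<And>t x. t \<le> x \<Longrightarrow> C * (LINT s:{t..x}|lborel. \<bar>q s\<bar> * W s) \<le> W t / 2"
    using exists_absorbing_weight[OF C q i2] by blast
  have "decaying_potential q b r C (C * M) (LINT t|lborel. exp (2 * b * \<bar>t\<bar>) * \<bar>q t\<bar>) W"
  proof
    show "C * W s \<le> C * M" for s using W(3) C by (intro mult_left_mono) auto
    show "C = 2 / (b - r)\<^sup>2" by (rule C_def)
  qed (use q b r i1 W in auto)
  thus ?thesis by (rule that)
qed

text \<open>Changing \<open>q\<close> on a null set and passing from the completed measure to Borel
  measure are done together; the factors \<open>f\<close> and \<open>g\<close> stay Borel, as all
  kernels and plane waves are.\<close>

lemma set_integral_lebesgue_eq_lborel:
  fixes q q' :: "real \<Rightarrow> real" and f g :: "real \<Rightarrow> complex"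
  assumes q: "q \<in> borel_measurable lebesgue" and q' [measurable]: "q' \<in> borel_measurable borel"
    and ae: "AE x in lebesgue. q x = q' x"
    and f [measurable]: "f \<in> borel_measurable borel" and g [measurable]: "g \<in> borel_measurable borel"
    and A [measurable]: "A \<in> sets borel"
  shows "set_integrable lebesgue A (\<lambda>t. f t * of_real (q t) * g t) \<longleftrightarrow>
      set_integrable lborel A (\<lambda>t. f t * of_real (q' t) * g t)" (is ?int)
    and "(LINT t:A|lebesgue. f t * of_real (q t) * g t) = (LINT t:A|lborel. f t * of_real (q' t) * g t)" (is ?eq)
proof -
  let ?F = "\<lambda>q t. indicator A t *\<^sub>R (f t * of_real (q t) * g t)"
  have m': "?F q' \<in> borel_measurable lborel" by measurable
  have m'': "?F q' \<in> borel_measurable lebesgue" by (rule measurable_completion[OF m'])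
  have AE_eq: "AE t in lebesgue. ?F q t = ?F q' t" using ae by eventually_elim simp
  have m: "?F q \<in> borel_measurable lebesgue"
  proof -
    have "f \<in> borel_measurable lebesgue" "g \<in> borel_measurable lebesgue" "A \<in> sets lebesgue"
      by (auto intro: measurable_completion)
    moreover have "(\<lambda>t. complex_of_real (q t)) \<in> borel_measurable lebesgue" using q by measurable
    ultimately show ?thesis
      by (intro borel_measurable_scaleR borel_measurable_indicator borel_measurable_times)
  qed
  show ?int
    unfolding set_integrable_def integrable_cong_AE[OF m m'' AE_eq] by (rule integrable_completion[OF m'])
  show ?eq
    unfolding set_lebesgue_integral_def integral_cong_AE[OF m m'' AE_eq] by (rule integral_completion[OF m'])
qed

text \<open>Equality holds at every point although the potentials agree only almost everywhere,
  because the potential enters the kernels only under an integral.\<close>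

lemma Khat_cong_AE:
  assumes q: "q \<in> borel_measurable lebesgue" and q' [measurable]: "q' \<in> borel_measurable borel"
    and ae: "AE x in lebesgue. q x = q' x"
  shows "Khat q n l x t = Khat q' n l x t"
proof (induction n arbitrary: t)
  case (Suc n)
  have "Khat q (Suc n) l x t = (LINT s:{t..x}|lebesgue. Khat q' n l x s * of_real (q s) * K1 l s t)"
    by (simp add: Suc)
  also have "\<dots> = (LINT s:{t..x}|lborel. Khat q' n l x s * of_real (q' s) * K1 l s t)"
    by (rule set_integral_lebesgue_eq_lborel(2)[OF q q' ae borel_measurable_Khat[OF q']]) measurable
  also have "\<dots> = Khat q' (Suc n) l x t"
    by (rule Khat_Suc_lborel[OF q' borel_measurable_Khat[OF q'], symmetric])
  finally show ?case .
qed simp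

lemma Khat_mult_zeta_1: "Khat q n (l * zeta 1) x t = Khat q n l x t"
  by (induction n arbitrary: t) (simp_all only: Khat.simps K1_mult_zeta_1)

lemma zeta_1_mult:
  assumes "k \<in> {0, 1, 2}"
  shows "zeta 1 * zeta k = zeta ((k + 1) mod 3)"
  using assms zeta_1_squared zeta_1_mult_2 by (auto simp: power2_eq_square numeral_2_eq_2)

theorem theorem1p2:
  fixes a :: real and q :: "real \<Rightarrow> real"
  assumes "a > 0"
    and "q \<in> borel_measurable lebesgue"
    and "integrable lebesgue (\<lambda>x. \<bar>q x\<bar>\<^sup>2 * exp (2 * a * \<bar>x\<bar>))"
  shows "(\<forall>l \<in> ball (0::complex) (a / 3). \<forall>x t. t \<le> x \<longrightarrow>
            (\<forall>n. set_integrable lebesgue {t..x}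
                   (\<lambda>s. Khat q n l x s * of_real (q s) * K1 l s t)) \<and>
            summable (\<lambda>n. \<i> ^ Suc n * Khat q n l x t)) \<and>
         (\<exists>u :: nat \<Rightarrow> complex \<Rightarrow> real \<Rightarrow> complex.
            (\<forall>l \<in> ball 0 (a / 3). \<forall>k \<in> {0, 1, 2}.
               jost_solution q k l (u k l) \<and>
               (\<forall>x. set_integrable lebesgue {..x}
                      (\<lambda>t. Nhat q l x t * of_real (q t) * exp (\<i> * l * zeta k * of_real t)) \<and>
                    u k l x = exp (\<i> * l * zeta k * of_real x) +
                      (LINT t:{..x}|lebesgue.
                         Nhat q l x t * of_real (q t) * exp (\<i> * l * zeta k * of_real t)))) \<and>
            (\<forall>k \<in> {0, 1, 2}. \<forall>x. (\<lambda>l. u k l x) analytic_on ball 0 (a / 3)) \<and>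
            (\<forall>l \<in> ball 0 (a / 3). \<forall>k \<in> {0, 1, 2}. \<forall>x.
               u k (l * zeta 1) x = u ((k + 1) mod 3) l x))"
proof -
  define b where "b = a / 3"
  have b: "b > 0" and ab: "a = 3 * b" using assms(1) by (simp_all add: b_def)
  obtain q' where q' [measurable]: "q' \<in> borel_measurable lborel" and "AE x in lborel. q x = q' x"
    using completion_ex_borel_measurable_real[OF assms(2)] by blast
  hence ae: "AE x in lebesgue. q x = q' x" by (intro AE_completion)
  have qm': "q' \<in> borel_measurable borel" using q' by simp
  have "integrable lebesgue (\<lambda>t. (q' t)\<^sup>2 * exp (2 * (3 * b) * \<bar>t\<bar>))"
  proof (rule integrable_cong_AE_imp[OF assms(3)])
    show "(\<lambda>t. (q' t)\<^sup>2 * exp (2 * (3 * b) * \<bar>t\<bar>)) \<in> borel_measurable lebesgue"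
      by (rule measurable_completion) measurable
    show "AE x in lebesgue. \<bar>q x\<bar>\<^sup>2 * exp (2 * a * \<bar>x\<bar>) = (q' x)\<^sup>2 * exp (2 * (3 * b) * \<bar>x\<bar>)"
      using ae by eventually_elim (simp add: ab)
  qed
  hence int: "integrable lborel (\<lambda>t. (q' t)\<^sup>2 * exp (2 * (3 * b) * \<bar>t\<bar>))"
    by (subst (asm) integrable_completion) auto
  note Khat_eq = Khat_cong_AE[OF assms(2) qm' ae]
  have Nhat_eq: "Nhat q l x t = Nhat q' l x t" for l x t by (simp add: Nhat_def Khat_eq)
  note leb = set_integral_lebesgue_eq_lborel[OF assms(2) qm' ae]
  \<comment> \<open>Defined by the explicit formula, free of \<open>r\<close>, so that the local
    results obtained below for different radii concern one and the same function.\<close>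
  define u where "u k l x = exp (\<i> * l * zeta k * of_real x) +
      (LINT t:{..x}|lebesgue. Nhat q l x t * of_real (q t) * exp (\<i> * l * zeta k * of_real t))" for k l x
  have wave: "(\<lambda>t. exp (\<i> * l * zeta k * complex_of_real t)) \<in> borel_measurable borel" for l k
    by (intro borel_measurable_continuous_onI continuous_intros)
  \<comment> \<open>All assertions at a single \<open>l\<close>, since the constants depend on a
    radius chosen for it; analyticity is likewise stated at the point \<open>l\<close>.\<close>
  have loc: "(\<forall>x t. t \<le> x \<longrightarrow> (\<forall>n. set_integrable lebesgue {t..x} (\<lambda>s. Khat q n l x s * of_real (q s) * K1 l s t)) \<and>
        summable (\<lambda>n. \<i> ^ Suc n * Khat q n l x t)) \<and>
      (\<forall>k. jost_solution q k l (u k l)) \<and>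
      (\<forall>k x. set_integrable lebesgue {..x} (\<lambda>t. Nhat q l x t * of_real (q t) * exp (\<i> * l * zeta k * of_real t))) \<and>
      (\<forall>k x. (\<lambda>l. u k l x) analytic_on {l})"
    if l: "l \<in> ball 0 b" for l
  proof -
    \<comment> \<open>The midpoint puts \<open>l\<close> in the open disc of radius
      \<open>r\<close>, and \<open>r\<close> strictly below \<open>b\<close>.\<close>
    define r where "r = (norm l + b) / 2"
    have lr: "norm l < r" "r < b" using l by (simp_all add: r_def)
    hence ler: "norm l \<le> r" by simp
    obtain C D Q W where "decaying_potential q' b r C D Q W"
      using exists_decaying_potential[OF qm' b lr(2) int] .
    then interpret decaying_potential q' b r C D Q W .
    have N: "set_integrable lebesgue {..x} (\<lambda>t. Nhat q m x t * of_real (q t) * exp (\<i> * m * zeta k * of_real t))"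
        "u k m x = jost k m x" if m: "norm m \<le> r" for k m x
      using Nhat_integral[OF m exp_bounded_plane_wave[OF m], of x k]
      unfolding u_def jost_def Nhat_eq leb[OF Nhat_measurable wave atMost_borel]
      by (simp_all only: mult.assoc)
    have u: "u k l = jost k l" for k using N(2)[OF ler] by (simp add: fun_eq_iff)
    have "set_integrable lebesgue {t..x} (\<lambda>s. Khat q n l x s * of_real (q s) * K1 l s t)" for t x n
      unfolding Khat_eq using Khat_integrand_integrable[OF ler]
      by (subst leb) auto
    moreover have "summable (\<lambda>n. \<i> ^ Suc n * Khat q n l x t)" if "t \<le> x" for t x
      unfolding Khat_eq by (rule Nhat_summable[OF ler that])
    moreover have "jost_solution q k l (u k l)" for k
    proof -
      from jost_solves_ode[OF ler, of k] obtain y1 y2 where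
        y: "\<forall>x. (jost k l has_vector_derivative y1 x) (at x)" "\<forall>x. (y1 has_vector_derivative y2 x) (at x)"
          "locally_abs_cont y2" and
        y3: "AE x in lebesgue. \<exists>y3. (y2 has_vector_derivative y3) (at x) \<and>
          \<i> * y3 + of_real (q' x) * jost k l x = l ^ 3 * jost k l x"
        unfolding solves_ode_def by blast
      \<comment> \<open>The equation is required almost everywhere only, so the Borel representative
        may be exchanged for \<open>q\<close>.\<close>
      from y3 ae have "AE x in lebesgue. \<exists>y3. (y2 has_vector_derivative y3) (at x) \<and>
          \<i> * y3 + of_real (q x) * jost k l x = l ^ 3 * jost k l x"
        by eventually_elim simp
      with y have "solves_ode q l (jost k l)" unfolding solves_ode_def by blast
      thus ?thesis unfolding u jost_solution_def using jost_asymptotics[OF ler] by blast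
    qed
    moreover have "(\<lambda>l. u k l x) analytic_on {l}" for k x
    proof -
      have "(\<lambda>l. u k l x) holomorphic_on ball 0 r"
        by (rule holomorphic_transform[OF jost_holomorphic[of k x]]) (simp add: N(2))
      hence "(\<lambda>l. u k l x) analytic_on ball 0 r" by (simp add: analytic_on_open)
      thus ?thesis by (rule analytic_on_subset) (use lr in simp)
    qed
    ultimately show ?thesis using N(1)[OF ler] by blast
  qed
  \<comment> \<open>This is an identity between the two formulas: the kernel is unchanged and the
    exponents coincide, as \<open>zeta 1 * zeta k\<close> is the next root in cyclic order.\<close>
  have sym: "u k (l * zeta 1) x = u ((k + 1) mod 3) l x" if "k \<in> {0, 1, 2}" for k l x
  proof -
    have e: "\<i> * (l * zeta 1) * zeta k * of_real y = \<i> * l * zeta ((k + 1) mod 3) * of_real y" for y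
      by (simp only: mult.assoc flip: zeta_1_mult[OF that])
    show ?thesis unfolding u_def e Nhat_def Khat_mult_zeta_1 ..
  qed
  have an: "(\<lambda>l. u k l x) analytic_on ball 0 b" for k x
    by (subst analytic_on_analytic_at) (use loc in blast)
  show ?thesis
    unfolding b_def[symmetric]
    by (intro conjI exI[of _ u] ballI allI impI an sym) (use loc in \<open>auto simp: u_def\<close>)
qed

end
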